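(* Let $\mathcal{C}$ be a pre-triangulated category and let $\mathcal{D}$ be an idempotent complete suspended category. Let $F\dashv G:\mathcal{D}\to\mathcal{C}$ be an adjunction of functors commuting with the suspension. Suppose that the stable monad $GF:\mathcal{C}\to\mathcal{C}$ is an exact functor and that $G$ is a stably semiseparable functor, and let $e:\mathrm{Id}_{\mathcal{D}}\to\mathrm{Id}_{\mathcal{D}}$ be the idempotent natural transformation associated to $G$. Then the coidentifier $\mathcal{D}_e$ (with the suspension $\Sigma_e$ induced by that of $\mathcal{D}$) is idempotent complete and pre-triangulated with distinguished triangles being exactly the ones whose image through the functor $G_e:\mathcal{D}_e\to\mathcal{C}$ (determined by the factorization $G=G_e\circ H$) is distinguished in $\mathcal{C}$. Moreover, with respect to this pre-triangulation, both the functor $G_e:\mathcal{D}_e\to\mathcal{C}$ and its left adjoint $F_e:=H\circ F:\mathcal{C}\to\mathcal{D}_e$ become exact.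
   Context: Suspended categories. A suspended category $(\mathcal{C},\Sigma)$ is an additive category $\mathcal{C}$ with an autoequivalence $\Sigma:\mathcal{C}\to\mathcal{C}$, the suspension, which is taken to be an isomorphism of categories ($\Sigma^{-1}\Sigma=\mathrm{Id}=\Sigma\Sigma^{-1}$). All suspensions are denoted by $\Sigma$. A functor $T$ between suspended categories commutes with suspension if $T\circ\Sigma=\Sigma\circ T$; a natural transformation $\alpha$ between such functors commutes with suspension if $\alpha\Sigma=\Sigma\alpha$. An adjunction of functors commuting with suspension is an adjunction $F\dashv G:\mathcal{D}\to\mathcal{C}$ (so $F:\mathcal{C}\to\mathcal{D}$ is left adjoint to $G$) between suspended categories such that $F$, $G$, the unit $\eta$ and the counit $\epsilon$ commute with suspension; then the monad $(GF,G\epsilon F,\eta)$ is stable, i.e. its functor, multiplication and unit commute with suspension. Pre-triangulated categories. A triangle in $(\mathcal{C},\Sigma)$ is a diagram $X\xrightarrow{u}Y\xrightarrow{v}Z\xrightarrow{w}\Sigma X$. A pre-triangulated category is a suspended category with a class of triangles, called distinguished, such that: any triangle isomorphic to a distinguished one is distinguished, and $X\xrightarrow{\mathrm{Id}}X\to0\to\Sigma X$ is distinguished; every morphism $u:X\to Y$ fits into a distinguished triangle $X\xrightarrow{u}Y\to Z\to\Sigma X$; $X\xrightarrow{u}Y\xrightarrow{v}Z\xrightarrow{w}\Sigma X$ is distinguished iff $Y\xrightarrow{-v}Z\xrightarrow{-w}\Sigma X\xrightarrow{-\Sigma u}\Sigma Y$ is; and for distinguished triangles $(u,v,w)$ and $(u',v',w')$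 and $f:X\to X'$, $g:Y\to Y'$ with $gu=u'f$ there is $h:Z\to Z'$ with $hv=v'g$ and $(\Sigma f)w=w'h$ (i.e. the axioms of a triangulated category without the octahedral axiom). A functor between pre-triangulated categories is exact if it commutes with the suspension and preserves distinguished triangles. Semiseparability. A functor $G:\mathcal{D}\to\mathcal{C}$ is semiseparable if there is a natural transformation $\mathcal{P}:\mathrm{Hom}_{\mathcal{C}}(G-,G-)\to\mathrm{Hom}_{\mathcal{D}}(-,-)$ with $\mathcal{G}\circ\mathcal{P}\circ\mathcal{G}=\mathcal{G}$, where $\mathcal{G}_{X,Y}(f)=G(f)$. If $\mathcal{C},\mathcal{D}$ are suspended and $G$ commutes with suspension, $G$ is stably semiseparable if it is semiseparable through some $\mathcal{P}$ with $\Sigma(\mathcal{P}_{X,Y}(g))=\mathcal{P}_{\Sigma X,\Sigma Y}(\Sigma g)$ for all $g:GX\to GY$. The associated idempotent natural transformation of a semiseparable $G$ is $e:\mathrm{Id}_{\mathcal{D}}\to\mathrm{Id}_{\mathcal{D}}$, $e_X=\mathcal{P}_{X,X}(\mathrm{Id}_{GX})$; it does not depend on $\mathcal{P}$, and is the unique idempotent natural transformation with $Ge=\mathrm{Id}_G$ such that for $f,g:A\to B$ in $\mathcal{D}$ one has $Gf=Gg$ iff $e_B\circ f=e_B\circ g$. If $G$ is stably semiseparable then $e\Sigma=\Sigma e$. Coidentifier. $\mathcal{D}_e$ is the quotient category $\mathcal{D}/\!\sim$ with the same objects, where $f\sim g$ (for $f,g:A\to B$) iff $e_B\circ f=e_B\circ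 g$; $H:\mathcal{D}\to\mathcal{D}_e$, the quotient functor, is the identity on objects and $f\mapsto\overline f$. $\mathcal{D}_e$ carries the induced additive structure $\overline f+\overline g=\overline{f+g}$, and the suspension $\Sigma_e$ is the unique functor with $\Sigma_e\circ H=H\circ\Sigma$, i.e. $\Sigma_eX=\Sigma X$, $\Sigma_e\overline f=\overline{\Sigma f}$. $G_e:\mathcal{D}_e\to\mathcal{C}$ is the unique functor with $G=G_e\circ H$. A category is idempotent complete if all its idempotent morphisms split. *)

theory Defs
  imports "HOL-Algebra.Group"
begin

section \<open>Categories and functors\<close>

text \<open>Every arrow has exactly one domain and one codomain, so the hom-sets are disjoint. Only the
  values of the operations on objects and on (composable or parallel) arrows matter.\<close>

record ('o, 'm) cat =
  Obj :: "'o set"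
  Arr :: "'m set"
  Dom :: "'m \<Rightarrow> 'o"
  Cod :: "'m \<Rightarrow> 'o"
  Ident :: "'o \<Rightarrow> 'm"
  Comp :: "'m \<Rightarrow> 'm \<Rightarrow> 'm"  (infixr "\<cdot>\<index>" 75)

definition Hom :: "('o, 'm, 'z) cat_scheme \<Rightarrow> 'o \<Rightarrow> 'o \<Rightarrow> 'm set" where
  "Hom C A B = {f \<in> Arr C. Dom C f = A \<and> Cod C f = B}"

locale category =
  fixes C :: "('o, 'm, 'z) cat_scheme" (structure)
  assumes dom_obj: "f \<in> Arr C \<Longrightarrow> Dom C f \<in> Obj C"
    and cod_obj: "f \<in> Arr C \<Longrightarrow> Cod C f \<in> Obj C"
    and ident_hom: "A \<in> Obj C \<Longrightarrow> Ident C A \<in> Hom C A A"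
    and comp_hom: "\<lbrakk>f \<in> Hom C A B; g \<in> Hom C B D\<rbrakk> \<Longrightarrow> g \<cdot> f \<in> Hom C A D"
    and ident_left: "f \<in> Hom C A B \<Longrightarrow> Ident C B \<cdot> f = f"
    and ident_right: "f \<in> Hom C A B \<Longrightarrow> f \<cdot> Ident C A = f"
    and comp_assoc: "\<lbrakk>f \<in> Hom C A B; g \<in> Hom C B D; h \<in> Hom C D E\<rbrakk>
      \<Longrightarrow> (h \<cdot> g) \<cdot> f = h \<cdot> (g \<cdot> f)"

definition is_iso :: "('o, 'm, 'z) cat_scheme \<Rightarrow> 'm \<Rightarrow> bool" where
  "is_iso C f \<longleftrightarrow> f \<in> Arr C \<and>
     (\<exists>g \<in> Hom C (Cod C f) (Dom C f).
        g \<cdot>\<^bsub>C\<^esub> f = Ident C (Dom C f) \<and> f \<cdot>\<^bsub>C\<^esub> g = Ident C (Cod C f))"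

definition zero_object :: "('o, 'm, 'z) cat_scheme \<Rightarrow> 'o \<Rightarrow> bool" where
  "zero_object C Z \<longleftrightarrow> Z \<in> Obj C \<and>
     (\<forall>X \<in> Obj C. (\<exists>!f. f \<in> Hom C X Z) \<and> (\<exists>!f. f \<in> Hom C Z X))"

definition idempotent_complete :: "('o, 'm, 'z) cat_scheme \<Rightarrow> bool" where
  "idempotent_complete C \<longleftrightarrow>
     (\<forall>X \<in> Obj C. \<forall>p \<in> Hom C X X. p \<cdot>\<^bsub>C\<^esub> p = p \<longrightarrow>
        (\<exists>Y \<in> Obj C. \<exists>r \<in> Hom C X Y. \<exists>s \<in> Hom C Y X.
           s \<cdot>\<^bsub>C\<^esub> r = p \<and> r \<cdot>\<^bsub>C\<^esub> s = Ident C Y))"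

record ('o1, 'm1, 'o2, 'm2) functor_data =
  ObjMap :: "'o1 \<Rightarrow> 'o2"
  ArrMap :: "'m1 \<Rightarrow> 'm2"

definition is_functor ::
  "('o1, 'm1, 'y) cat_scheme \<Rightarrow> ('o2, 'm2, 'z) cat_scheme \<Rightarrow>
   ('o1, 'm1, 'o2, 'm2) functor_data \<Rightarrow> bool" where
  "is_functor C D F \<longleftrightarrow> category C \<and> category D \<and>
     (\<forall>X \<in> Obj C. ObjMap F X \<in> Obj D) \<and>
     (\<forall>X \<in> Obj C. \<forall>Y \<in> Obj C. \<forall>f \<in> Hom C X Y. ArrMap F f \<in> Hom D (ObjMap F X) (ObjMap F Y)) \<and>
     (\<forall>X \<in> Obj C. ArrMap F (Ident C X) = Ident D (ObjMap F X)) \<and>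
     (\<forall>f \<in> Arr C. \<forall>g \<in> Arr C. Cod C f = Dom C g \<longrightarrow>
        ArrMap F (g \<cdot>\<^bsub>C\<^esub> f) = ArrMap F g \<cdot>\<^bsub>D\<^esub> ArrMap F f)"

definition id_functor :: "('o, 'm, 'o, 'm) functor_data" where
  "id_functor = \<lparr>ObjMap = (\<lambda>X. X), ArrMap = (\<lambda>f. f)\<rparr>"

definition comp_functor ::
  "('o2, 'm2, 'o3, 'm3) functor_data \<Rightarrow> ('o1, 'm1, 'o2, 'm2) functor_data \<Rightarrow>
   ('o1, 'm1, 'o3, 'm3) functor_data"  (infixr "\<circ>\<^sub>F" 55) where
  "G \<circ>\<^sub>F F = \<lparr>ObjMap = ObjMap G \<circ> ObjMap F, ArrMap = ArrMap G \<circ> ArrMap F\<rparr>"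

text \<open>Equality of functors with source C, ignoring values outside of C.\<close>

definition functor_eq ::
  "('o1, 'm1, 'z) cat_scheme \<Rightarrow> ('o1, 'm1, 'o2, 'm2) functor_data \<Rightarrow>
   ('o1, 'm1, 'o2, 'm2) functor_data \<Rightarrow> bool" where
  "functor_eq C F G \<longleftrightarrow> (\<forall>X \<in> Obj C. ObjMap F X = ObjMap G X) \<and>
     (\<forall>f \<in> Arr C. ArrMap F f = ArrMap G f)"

definition nat_trans ::
  "('o1, 'm1, 'y) cat_scheme \<Rightarrow> ('o2, 'm2, 'z) cat_scheme \<Rightarrow>
   ('o1, 'm1, 'o2, 'm2) functor_data \<Rightarrow> ('o1, 'm1, 'o2, 'm2) functor_data \<Rightarrow>
   ('o1 \<Rightarrow> 'm2) \<Rightarrow> bool" where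
  "nat_trans C D F G \<alpha> \<longleftrightarrow> is_functor C D F \<and> is_functor C D G \<and>
     (\<forall>X \<in> Obj C. \<alpha> X \<in> Hom D (ObjMap F X) (ObjMap G X)) \<and>
     (\<forall>f \<in> Arr C. \<alpha> (Cod C f) \<cdot>\<^bsub>D\<^esub> ArrMap F f = ArrMap G f \<cdot>\<^bsub>D\<^esub> \<alpha> (Dom C f))"

text \<open>The functor F from C to D is left adjoint to G, with unit \<open>\<eta>\<close> and counit \<open>\<epsilon>\<close>.\<close>

definition adjunction ::
  "('o1, 'm1, 'y) cat_scheme \<Rightarrow> ('o2, 'm2, 'z) cat_scheme \<Rightarrow>
   ('o1, 'm1, 'o2, 'm2) functor_data \<Rightarrow> ('o2, 'm2, 'o1, 'm1) functor_data \<Rightarrow>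
   ('o1 \<Rightarrow> 'm1) \<Rightarrow> ('o2 \<Rightarrow> 'm2) \<Rightarrow> bool" where
  "adjunction C D F G \<eta> \<epsilon> \<longleftrightarrow> is_functor C D F \<and> is_functor D C G \<and>
     nat_trans C C id_functor (G \<circ>\<^sub>F F) \<eta> \<and> nat_trans D D (F \<circ>\<^sub>F G) id_functor \<epsilon> \<and>
     (\<forall>X \<in> Obj C. \<epsilon> (ObjMap F X) \<cdot>\<^bsub>D\<^esub> ArrMap F (\<eta> X) = Ident D (ObjMap F X)) \<and>
     (\<forall>Y \<in> Obj D. ArrMap G (\<epsilon> Y) \<cdot>\<^bsub>C\<^esub> \<eta> (ObjMap G Y) = Ident C (ObjMap G Y))"


section \<open>Additive and suspended categories\<close>

record ('o, 'm) preadd_cat = "('o, 'm) cat" +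
  Add :: "'m \<Rightarrow> 'm \<Rightarrow> 'm"  (infixl "\<oplus>\<index>" 65)
  Zero :: "'o \<Rightarrow> 'o \<Rightarrow> 'm"

definition hom_group :: "('o, 'm, 'z) preadd_cat_scheme \<Rightarrow> 'o \<Rightarrow> 'o \<Rightarrow> 'm monoid" where
  "hom_group C A B = \<lparr>carrier = Hom C A B, monoid.mult = Add C, one = Zero C A B\<rparr>"

definition Neg :: "('o, 'm, 'z) preadd_cat_scheme \<Rightarrow> 'm \<Rightarrow> 'm" where
  "Neg C f = m_inv (hom_group C (Dom C f) (Cod C f)) f"

locale preadditive_category = category C
  for C :: "('o, 'm, 'z) preadd_cat_scheme" (structure) +
  assumes hom_comm_group: "\<lbrakk>A \<in> Obj C; B \<in> Obj C\<rbrakk> \<Longrightarrow> comm_group (hom_group C A B)"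
    and comp_add_left: "\<lbrakk>f \<in> Hom C A B; g \<in> Hom C B D; h \<in> Hom C B D\<rbrakk>
      \<Longrightarrow> (g \<oplus> h) \<cdot> f = (g \<cdot> f) \<oplus> (h \<cdot> f)"
    and comp_add_right: "\<lbrakk>f \<in> Hom C A B; g \<in> Hom C A B; h \<in> Hom C B D\<rbrakk>
      \<Longrightarrow> h \<cdot> (f \<oplus> g) = (h \<cdot> f) \<oplus> (h \<cdot> g)"

locale additive_category = preadditive_category C
  for C :: "('o, 'm, 'z) preadd_cat_scheme" (structure) +
  assumes ex_zero_object: "\<exists>Z. zero_object C Z"
    and ex_biproduct: "\<lbrakk>A \<in> Obj C; B \<in> Obj C\<rbrakk> \<Longrightarrow>
      \<exists>P \<in> Obj C. \<exists>i \<in> Hom C A P. \<exists>j \<in> Hom C B P. \<exists>p \<in> Hom C P A. \<exists>q \<in> Hom C P B.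
        p \<cdot> i = Ident C A \<and> q \<cdot> j = Ident C B \<and>
        p \<cdot> j = Zero C B A \<and> q \<cdot> i = Zero C A B \<and>
        (i \<cdot> p) \<oplus> (j \<cdot> q) = Ident C P"

record ('o, 'm) susp_cat = "('o, 'm) preadd_cat" +
  Susp :: "('o, 'm, 'o, 'm) functor_data"

locale suspended_category = additive_category C
  for C :: "('o, 'm, 'z) susp_cat_scheme" (structure) +
  assumes susp_functor: "is_functor C C (Susp C)"
    and susp_invertible: "\<exists>S. is_functor C C S \<and>
      functor_eq C (S \<circ>\<^sub>F Susp C) id_functor \<and> functor_eq C (Susp C \<circ>\<^sub>F S) id_functor"

definition functor_commutes_susp ::
  "('o1, 'm1, 'y) susp_cat_scheme \<Rightarrow> ('o2, 'm2, 'z) susp_cat_scheme \<Rightarrow>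
   ('o1, 'm1, 'o2, 'm2) functor_data \<Rightarrow> bool" where
  "functor_commutes_susp C D T \<longleftrightarrow> functor_eq C (T \<circ>\<^sub>F Susp C) (Susp D \<circ>\<^sub>F T)"

definition trans_commutes_susp ::
  "('o1, 'm1, 'y) susp_cat_scheme \<Rightarrow> ('o2, 'm2, 'z) susp_cat_scheme \<Rightarrow>
   ('o1 \<Rightarrow> 'm2) \<Rightarrow> bool" where
  "trans_commutes_susp C D \<alpha> \<longleftrightarrow>
     (\<forall>X \<in> Obj C. \<alpha> (ObjMap (Susp C) X) = ArrMap (Susp D) (\<alpha> X))"

definition susp_adjunction ::
  "('o1, 'm1, 'y) susp_cat_scheme \<Rightarrow> ('o2, 'm2, 'z) susp_cat_scheme \<Rightarrow>
   ('o1, 'm1, 'o2, 'm2) functor_data \<Rightarrow> ('o2, 'm2, 'o1, 'm1) functor_data \<Rightarrow>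
   ('o1 \<Rightarrow> 'm1) \<Rightarrow> ('o2 \<Rightarrow> 'm2) \<Rightarrow> bool" where
  "susp_adjunction C D F G \<eta> \<epsilon> \<longleftrightarrow> adjunction C D F G \<eta> \<epsilon> \<and>
     functor_commutes_susp C D F \<and> functor_commutes_susp D C G \<and>
     trans_commutes_susp C C \<eta> \<and> trans_commutes_susp D D \<epsilon>"


section \<open>Pre-triangulated categories\<close>

text \<open>A triangle is given by its three arrows; these determine its objects.\<close>

type_synonym 'm triangle = "'m \<times> 'm \<times> 'm"

definition triangles :: "('o, 'm, 'z) susp_cat_scheme \<Rightarrow> 'm triangle set" where
  "triangles C = {(u, v, w). u \<in> Arr C \<and> v \<in> Arr C \<and> w \<in> Arr C \<and>
     Cod C u = Dom C v \<and> Cod C v = Dom C w \<and> Cod C w = ObjMap (Susp C) (Dom C u)}"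

fun triangle_map ::
  "('o, 'm, 'z) susp_cat_scheme \<Rightarrow> 'm triangle \<Rightarrow> 'm triangle \<Rightarrow> 'm \<Rightarrow> 'm \<Rightarrow> 'm \<Rightarrow> bool" where
  "triangle_map C (u, v, w) (u', v', w') f g h \<longleftrightarrow>
     f \<in> Hom C (Dom C u) (Dom C u') \<and>
     g \<in> Hom C (Dom C v) (Dom C v') \<and>
     h \<in> Hom C (Dom C w) (Dom C w') \<and>
     g \<cdot>\<^bsub>C\<^esub> u = u' \<cdot>\<^bsub>C\<^esub> f \<and>
     h \<cdot>\<^bsub>C\<^esub> v = v' \<cdot>\<^bsub>C\<^esub> g \<and>
     ArrMap (Susp C) f \<cdot>\<^bsub>C\<^esub> w = w' \<cdot>\<^bsub>C\<^esub> h"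

definition triangle_iso ::
  "('o, 'm, 'z) susp_cat_scheme \<Rightarrow> 'm triangle \<Rightarrow> 'm triangle \<Rightarrow> bool" where
  "triangle_iso C t t' \<longleftrightarrow> (\<exists>f g h. triangle_map C t t' f g h \<and> is_iso C f \<and> is_iso C g \<and> is_iso C h)"

locale pretriangulated_category = suspended_category C
  for C :: "('o, 'm, 'z) susp_cat_scheme" (structure) and \<Delta> :: "'m triangle set" +
  assumes distinguished_triangles: "\<Delta> \<subseteq> triangles C"
    and iso_closed: "\<lbrakk>t \<in> \<Delta>; t' \<in> triangles C; triangle_iso C t t'\<rbrakk> \<Longrightarrow> t' \<in> \<Delta>"
    and ident_distinguished: "\<lbrakk>X \<in> Obj C; zero_object C Z\<rbrakk>
      \<Longrightarrow> (Ident C X, Zero C X Z, Zero C Z (ObjMap (Susp C) X)) \<in> \<Delta>"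
    and ex_distinguished: "u \<in> Arr C \<Longrightarrow> \<exists>v w. (u, v, w) \<in> \<Delta>"
    and rotate: "(u, v, w) \<in> triangles C \<Longrightarrow>
      (u, v, w) \<in> \<Delta> \<longleftrightarrow> (Neg C v, Neg C w, Neg C (ArrMap (Susp C) u)) \<in> \<Delta>"
    and ex_completion: "\<lbrakk>(u, v, w) \<in> \<Delta>; (u', v', w') \<in> \<Delta>;
      f \<in> Hom C (Dom C u) (Dom C u'); g \<in> Hom C (Cod C u) (Cod C u'); g \<cdot> u = u' \<cdot> f\<rbrakk>
      \<Longrightarrow> \<exists>h. triangle_map C (u, v, w) (u', v', w') f g h"

fun map_triangle :: "('o1, 'm1, 'o2, 'm2) functor_data \<Rightarrow> 'm1 triangle \<Rightarrow> 'm2 triangle" where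
  "map_triangle F (u, v, w) = (ArrMap F u, ArrMap F v, ArrMap F w)"

definition exact_functor ::
  "('o1, 'm1, 'y) susp_cat_scheme \<Rightarrow> 'm1 triangle set \<Rightarrow>
   ('o2, 'm2, 'z) susp_cat_scheme \<Rightarrow> 'm2 triangle set \<Rightarrow>
   ('o1, 'm1, 'o2, 'm2) functor_data \<Rightarrow> bool" where
  "exact_functor C \<Delta> D \<Delta>' F \<longleftrightarrow> is_functor C D F \<and> functor_commutes_susp C D F \<and>
     (\<forall>t \<in> \<Delta>. map_triangle F t \<in> \<Delta>')"


section \<open>Semiseparable functors\<close>

definition semiseparable_via ::
  "('o2, 'm2, 'y) cat_scheme \<Rightarrow> ('o1, 'm1, 'z) cat_scheme \<Rightarrow>
   ('o2, 'm2, 'o1, 'm1) functor_data \<Rightarrow> ('o2 \<Rightarrow> 'o2 \<Rightarrow> 'm1 \<Rightarrow> 'm2) \<Rightarrow> bool" where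
  "semiseparable_via D C G P \<longleftrightarrow> is_functor D C G \<and>
     (\<forall>X \<in> Obj D. \<forall>Y \<in> Obj D. \<forall>k \<in> Hom C (ObjMap G X) (ObjMap G Y). P X Y k \<in> Hom D X Y) \<and>
     (\<forall>X \<in> Obj D. \<forall>Y \<in> Obj D. \<forall>X' \<in> Obj D. \<forall>Y' \<in> Obj D.
        \<forall>f \<in> Hom D X' X. \<forall>g \<in> Hom D Y Y'. \<forall>k \<in> Hom C (ObjMap G X) (ObjMap G Y).
          P X' Y' (ArrMap G g \<cdot>\<^bsub>C\<^esub> (k \<cdot>\<^bsub>C\<^esub> ArrMap G f)) = g \<cdot>\<^bsub>D\<^esub> (P X Y k \<cdot>\<^bsub>D\<^esub> f)) \<and>
     (\<forall>X \<in> Obj D. \<forall>Y \<in> Obj D. \<forall>f \<in> Hom D X Y.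
        ArrMap G (P X Y (ArrMap G f)) = ArrMap G f)"

definition stably_semiseparable ::
  "('o2, 'm2, 'y) susp_cat_scheme \<Rightarrow> ('o1, 'm1, 'z) susp_cat_scheme \<Rightarrow>
   ('o2, 'm2, 'o1, 'm1) functor_data \<Rightarrow> bool" where
  "stably_semiseparable D C G \<longleftrightarrow> functor_commutes_susp D C G \<and>
     (\<exists>P. semiseparable_via D C G P \<and>
       (\<forall>X \<in> Obj D. \<forall>Y \<in> Obj D. \<forall>k \<in> Hom C (ObjMap G X) (ObjMap G Y).
          ArrMap (Susp D) (P X Y k) =
          P (ObjMap (Susp D) X) (ObjMap (Susp D) Y) (ArrMap (Susp C) k)))"

text \<open>The transformation P need not be the one witnessing stability: the associated idempotent
  does not depend on it.\<close>

definition associated_idempotent ::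
  "('o2, 'm2, 'y) cat_scheme \<Rightarrow> ('o1, 'm1, 'z) cat_scheme \<Rightarrow>
   ('o2, 'm2, 'o1, 'm1) functor_data \<Rightarrow> ('o2 \<Rightarrow> 'm2) \<Rightarrow> bool" where
  "associated_idempotent D C G e \<longleftrightarrow>
     (\<exists>P. semiseparable_via D C G P \<and>
       (\<forall>X \<in> Obj D. e X = P X X (Ident C (ObjMap G X))))"


section \<open>The coidentifier\<close>

definition coid_rel :: "('o, 'm, 'z) cat_scheme \<Rightarrow> ('o \<Rightarrow> 'm) \<Rightarrow> 'm rel" where
  "coid_rel D e = {(f, g). f \<in> Arr D \<and> g \<in> Arr D \<and> Dom D f = Dom D g \<and> Cod D f = Cod D g \<and>
     e (Cod D f) \<cdot>\<^bsub>D\<^esub> f = e (Cod D g) \<cdot>\<^bsub>D\<^esub> g}"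

definition coid_class :: "('o, 'm, 'z) cat_scheme \<Rightarrow> ('o \<Rightarrow> 'm) \<Rightarrow> 'm \<Rightarrow> 'm set" where
  "coid_class D e f = coid_rel D e `` {f}"

definition rep :: "'m set \<Rightarrow> 'm" where
  "rep K = (SOME f. f \<in> K)"

text \<open>The operations on classes are computed on chosen representatives; the lemmas at the end show
  that the choice is immaterial.\<close>

definition coidentifier ::
  "('o, 'm, 'z) susp_cat_scheme \<Rightarrow> ('o \<Rightarrow> 'm) \<Rightarrow> ('o, 'm set) susp_cat" where
  "coidentifier D e =
    \<lparr>Obj = Obj D,
     Arr = Arr D // coid_rel D e,
     Dom = (\<lambda>K. Dom D (rep K)),
     Cod = (\<lambda>K. Cod D (rep K)),
     Ident = (\<lambda>X. coid_class D e (Ident D X)),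
     Comp = (\<lambda>K L. coid_class D e (rep K \<cdot>\<^bsub>D\<^esub> rep L)),
     Add = (\<lambda>K L. coid_class D e (rep K \<oplus>\<^bsub>D\<^esub> rep L)),
     Zero = (\<lambda>X Y. coid_class D e (Zero D X Y)),
     Susp = \<lparr>ObjMap = ObjMap (Susp D),
             ArrMap = (\<lambda>K. coid_class D e (ArrMap (Susp D) (rep K)))\<rparr>\<rparr>"

definition quotient_functor ::
  "('o, 'm, 'z) cat_scheme \<Rightarrow> ('o \<Rightarrow> 'm) \<Rightarrow> ('o, 'm, 'o, 'm set) functor_data" where
  "quotient_functor D e = \<lparr>ObjMap = (\<lambda>X. X), ArrMap = coid_class D e\<rparr>"

definition coid_factor ::
  "('o2, 'm2, 'o1, 'm1) functor_data \<Rightarrow> ('o2, 'm2 set, 'o1, 'm1) functor_data" where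
  "coid_factor G = \<lparr>ObjMap = ObjMap G, ArrMap = (\<lambda>K. ArrMap G (rep K))\<rparr>"

definition coid_distinguished ::
  "('o2, 'm2, 'y) susp_cat_scheme \<Rightarrow> ('o2 \<Rightarrow> 'm2) \<Rightarrow>
   ('o2, 'm2, 'o1, 'm1) functor_data \<Rightarrow> 'm1 triangle set \<Rightarrow> 'm2 set triangle set" where
  "coid_distinguished D e G \<Delta> =
     {t \<in> triangles (coidentifier D e). map_triangle (coid_factor G) t \<in> \<Delta>}"


lemma associated_idempotent_nat_trans:
  assumes "associated_idempotent D C G e"
  shows "nat_trans D D id_functor id_functor e"
    and "X \<in> Obj D \<Longrightarrow> ArrMap G (e X) = Ident C (ObjMap G X)"
proof -
  obtain P where P: "semiseparable_via D C G P"
    and e: "\<And>X. X \<in> Obj D \<Longrightarrow> e X = P X X (Ident C (ObjMap G X))"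
    using assms by (auto simp: associated_idempotent_def)
  have fG: "is_functor D C G" using P by (simp add: semiseparable_via_def)
  interpret D: category D using fG by (simp add: is_functor_def)
  interpret C: category C using fG by (simp add: is_functor_def)
  have Pty: "P X Y k \<in> Hom D X Y"
    if "X \<in> Obj D" "Y \<in> Obj D" "k \<in> Hom C (ObjMap G X) (ObjMap G Y)" for X Y k
    using P that by (simp add: semiseparable_via_def)
  have Pnat: "P X' Y' (ArrMap G g \<cdot>\<^bsub>C\<^esub> (k \<cdot>\<^bsub>C\<^esub> ArrMap G f)) = g \<cdot>\<^bsub>D\<^esub> (P X Y k \<cdot>\<^bsub>D\<^esub> f)"
    if "X \<in> Obj D" "Y \<in> Obj D" "X' \<in> Obj D" "Y' \<in> Obj D" "f \<in> Hom D X' X" "g \<in> Hom D Y Y'"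
      "k \<in> Hom C (ObjMap G X) (ObjMap G Y)" for X Y X' Y' f g k
    using P that unfolding semiseparable_via_def by blast
  have Gobj: "ObjMap G X \<in> Obj C" if "X \<in> Obj D" for X
    using fG that by (simp add: is_functor_def)
  have Garr: "ArrMap G f \<in> Hom C (ObjMap G X) (ObjMap G Y)"
    if "X \<in> Obj D" "Y \<in> Obj D" "f \<in> Hom D X Y" for X Y f
    using fG that by (simp add: is_functor_def)
  have Gid: "ArrMap G (Ident D X) = Ident C (ObjMap G X)" if "X \<in> Obj D" for X
    using fG that by (simp add: is_functor_def)
  have ety: "e X \<in> Hom D X X" if "X \<in> Obj D" for X
    using that e Pty C.ident_hom Gobj by simp
  have nat: "e Y \<cdot>\<^bsub>D\<^esub> f = f \<cdot>\<^bsub>D\<^esub> e X" if X: "X \<in> Obj D" and Y: "Y \<in> Obj D" and f: "f \<in> Hom D X Y" for X Y f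
  proof -
    note Gf = Garr[OF X Y f]
    have "e Y \<cdot>\<^bsub>D\<^esub> f = Ident D Y \<cdot>\<^bsub>D\<^esub> (P Y Y (Ident C (ObjMap G Y)) \<cdot>\<^bsub>D\<^esub> f)"
      using e[OF Y] D.ident_left D.comp_hom[OF f ety[OF Y]] by simp
    also have "\<dots> = P X Y (ArrMap G (Ident D Y) \<cdot>\<^bsub>C\<^esub> (Ident C (ObjMap G Y) \<cdot>\<^bsub>C\<^esub> ArrMap G f))"
      using Pnat[OF Y Y X Y f D.ident_hom[OF Y] C.ident_hom[OF Gobj[OF Y]]] by simp
    also have "\<dots> = P X Y (ArrMap G f)"
      by (simp add: Gid[OF Y] C.ident_left[OF Gf])
    also have "\<dots> = P X Y (ArrMap G f \<cdot>\<^bsub>C\<^esub> (Ident C (ObjMap G X) \<cdot>\<^bsub>C\<^esub> ArrMap G (Ident D X)))"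
      using Gid[OF X] C.ident_right[OF Gf] C.ident_right[OF C.ident_hom[OF Gobj[OF X]]] by simp
    also have "\<dots> = f \<cdot>\<^bsub>D\<^esub> (P X X (Ident C (ObjMap G X)) \<cdot>\<^bsub>D\<^esub> Ident D X)"
      using Pnat[OF X X X Y D.ident_hom[OF X] f C.ident_hom[OF Gobj[OF X]]] by simp
    also have "\<dots> = f \<cdot>\<^bsub>D\<^esub> e X"
      using e[OF X] D.ident_right[OF ety[OF X]] by simp
    finally show ?thesis .
  qed
  have "is_functor D D id_functor"
    by (simp add: is_functor_def id_functor_def D.category_axioms)
  then show "nat_trans D D id_functor id_functor e"
    unfolding nat_trans_def
    by (auto simp: id_functor_def ety intro!: nat D.dom_obj D.cod_obj)
       (auto simp: Hom_def)
  show "ArrMap G (e X) = Ident C (ObjMap G X)" if X: "X \<in> Obj D"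
  proof -
    have "ArrMap G (P X X (ArrMap G (Ident D X))) = ArrMap G (Ident D X)"
      using P X D.ident_hom unfolding semiseparable_via_def by blast
    then show ?thesis using e[OF X] Gid[OF X] by simp
  qed
qed

lemma equiv_coid_rel: "equiv (Arr D) (coid_rel D e)"
  by (auto simp: equiv_def refl_on_def sym_def trans_def coid_rel_def)

lemma coid_relD: "(f, g) \<in> coid_rel D e \<Longrightarrow> e (Cod D f) \<cdot>\<^bsub>D\<^esub> f = e (Cod D f) \<cdot>\<^bsub>D\<^esub> g"
  unfolding coid_rel_def by (metis (mono_tags, lifting) case_prodD mem_Collect_eq)

lemma rep_coid_class:
  assumes "f \<in> Arr D"
  shows "(f, rep (coid_class D e f)) \<in> coid_rel D e"
proof -
  have "f \<in> coid_class D e f"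
    using assms by (simp add: coid_class_def coid_rel_def)
  then have "rep (coid_class D e f) \<in> coid_class D e f"
    unfolding rep_def by (rule someI)
  then show ?thesis by (simp add: coid_class_def)
qed

lemma coid_class_eq_iff:
  assumes "f \<in> Arr D" "g \<in> Arr D"
  shows "coid_class D e f = coid_class D e g \<longleftrightarrow> (f, g) \<in> coid_rel D e"
  unfolding coid_class_def using equiv_coid_rel assms by (metis eq_equiv_class_iff)

lemma coid_dom_cod:
  assumes "f \<in> Arr D"
  shows "Dom (coidentifier D e) (coid_class D e f) = Dom D f"
    and "Cod (coidentifier D e) (coid_class D e f) = Cod D f"
  using rep_coid_class[OF assms, of e] by (auto simp: coidentifier_def coid_rel_def)

lemma coid_comp:
  assumes nt: "nat_trans D D id_functor id_functor e"
    and f: "f \<in> Arr D" and g: "g \<in> Arr D" and fg: "Cod D f = Dom D g"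
  shows "coid_class D e g \<cdot>\<^bsub>coidentifier D e\<^esub> coid_class D e f = coid_class D e (g \<cdot>\<^bsub>D\<^esub> f)"
proof -
  interpret D: category D using nt by (simp add: nat_trans_def is_functor_def)
  let ?f = "rep (coid_class D e f)" and ?g = "rep (coid_class D e g)"
  have rf: "(f, ?f) \<in> coid_rel D e" and rg: "(g, ?g) \<in> coid_rel D e"
    using f g by (auto intro: rep_coid_class)
  define A B E where "A = Dom D f" and "B = Cod D f" and "E = Cod D g"
  have h: "f \<in> Hom D A B" "?f \<in> Hom D A B" "g \<in> Hom D B E" "?g \<in> Hom D B E"
    using rf rg fg by (auto simp: coid_rel_def Hom_def A_def B_def E_def)
  have ef: "e B \<cdot>\<^bsub>D\<^esub> f = e B \<cdot>\<^bsub>D\<^esub> ?f" and eg: "e E \<cdot>\<^bsub>D\<^esub> g = e E \<cdot>\<^bsub>D\<^esub> ?g"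
    using coid_relD[OF rf] coid_relD[OF rg] by (auto simp: B_def E_def)
  have BE: "B \<in> Obj D" "E \<in> Obj D"
    using f g D.cod_obj by (auto simp: B_def E_def)
  have eB: "e B \<in> Hom D B B" and eE: "e E \<in> Hom D E E"
    using nt BE by (auto simp: nat_trans_def id_functor_def)
  have natg: "e E \<cdot>\<^bsub>D\<^esub> k = k \<cdot>\<^bsub>D\<^esub> e B" if "k \<in> Hom D B E" for k
    using nt that by (auto simp: nat_trans_def id_functor_def Hom_def)
  have "e E \<cdot>\<^bsub>D\<^esub> (g \<cdot>\<^bsub>D\<^esub> f) = (e E \<cdot>\<^bsub>D\<^esub> ?g) \<cdot>\<^bsub>D\<^esub> f"
    using D.comp_assoc[OF h(1) h(3) eE] eg by simp
  also have "\<dots> = ?g \<cdot>\<^bsub>D\<^esub> (e B \<cdot>\<^bsub>D\<^esub> f)"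
    using natg[OF h(4)] D.comp_assoc[OF h(1) eB h(4)] by simp
  also have "\<dots> = e E \<cdot>\<^bsub>D\<^esub> (?g \<cdot>\<^bsub>D\<^esub> ?f)"
    using ef natg[OF h(4)] D.comp_assoc[OF h(2) eB h(4)] D.comp_assoc[OF h(2) h(4) eE] by simp
  finally have "(g \<cdot>\<^bsub>D\<^esub> f, ?g \<cdot>\<^bsub>D\<^esub> ?f) \<in> coid_rel D e"
    using D.comp_hom[OF h(1) h(3)] D.comp_hom[OF h(2) h(4)] by (auto simp: coid_rel_def Hom_def)
  then show ?thesis
    unfolding coid_class_def by (simp add: coidentifier_def coid_class_def[symmetric])
      (metis coid_class_def equiv_coid_rel equiv_class_eq)
qed

lemma coid_add:
  assumes D: "preadditive_category D" and nt: "nat_trans D D id_functor id_functor e"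
    and f: "f \<in> Arr D" and g: "g \<in> Arr D" and fg: "Dom D f = Dom D g" "Cod D f = Cod D g"
  shows "coid_class D e f \<oplus>\<^bsub>coidentifier D e\<^esub> coid_class D e g = coid_class D e (f \<oplus>\<^bsub>D\<^esub> g)"
proof -
  interpret D: preadditive_category D by (rule D)
  let ?f = "rep (coid_class D e f)" and ?g = "rep (coid_class D e g)"
  have rf: "(f, ?f) \<in> coid_rel D e" and rg: "(g, ?g) \<in> coid_rel D e"
    using f g by (auto intro: rep_coid_class)
  define A B where "A = Dom D f" and "B = Cod D f"
  have AB: "A \<in> Obj D" "B \<in> Obj D"
    using f D.dom_obj D.cod_obj by (auto simp: A_def B_def)
  have h: "f \<in> Hom D A B" "?f \<in> Hom D A B" "g \<in> Hom D A B" "?g \<in> Hom D A B"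
    using rf rg fg by (auto simp: coid_rel_def Hom_def A_def B_def)
  have eB: "e B \<in> Hom D B B"
    using nt AB by (auto simp: nat_trans_def id_functor_def)
  have add: "x \<oplus>\<^bsub>D\<^esub> y \<in> Hom D A B" if "x \<in> Hom D A B" "y \<in> Hom D A B" for x y
  proof -
    interpret H: comm_group "hom_group D A B" by (rule D.hom_comm_group[OF AB])
    show ?thesis using H.m_closed[of x y] that by (simp add: hom_group_def)
  qed
  have "e B \<cdot>\<^bsub>D\<^esub> (f \<oplus>\<^bsub>D\<^esub> g) = e B \<cdot>\<^bsub>D\<^esub> (?f \<oplus>\<^bsub>D\<^esub> ?g)"
    using coid_relD[OF rf] coid_relD[OF rg] fg(2)
      D.comp_add_right[OF h(1) h(3) eB] D.comp_add_right[OF h(2) h(4) eB]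
    by (metis B_def)
  then have "(f \<oplus>\<^bsub>D\<^esub> g, ?f \<oplus>\<^bsub>D\<^esub> ?g) \<in> coid_rel D e"
    using add[OF h(1) h(3)] add[OF h(2) h(4)] by (auto simp: coid_rel_def Hom_def)
  then show ?thesis
    by (simp add: coidentifier_def) (metis coid_class_def equiv_coid_rel equiv_class_eq)
qed

lemma coid_susp:
  assumes D: "suspended_category D" and nt: "nat_trans D D id_functor id_functor e"
    and e\<Sigma>: "trans_commutes_susp D D e"
  shows "functor_eq D (Susp (coidentifier D e) \<circ>\<^sub>F quotient_functor D e) (quotient_functor D e \<circ>\<^sub>F Susp D)"
proof -
  interpret D: suspended_category D by (rule D)
  have "coid_class D e (ArrMap (Susp D) (rep (coid_class D e f))) = coid_class D e (ArrMap (Susp D) f)"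
    if f: "f \<in> Arr D" for f
  proof -
    let ?f = "rep (coid_class D e f)"
    have rf: "(f, ?f) \<in> coid_rel D e" using f by (rule rep_coid_class)
    define A B where "A = Dom D f" and "B = Cod D f"
    have AB: "A \<in> Obj D" "B \<in> Obj D"
      using f D.dom_obj D.cod_obj by (auto simp: A_def B_def)
    have h: "f \<in> Hom D A B" "?f \<in> Hom D A B"
      using rf by (auto simp: coid_rel_def Hom_def A_def B_def)
    have eB: "e B \<in> Hom D B B"
      using nt AB by (auto simp: nat_trans_def id_functor_def)
    have S: "ArrMap (Susp D) k \<in> Hom D (ObjMap (Susp D) A) (ObjMap (Susp D) B)" if "k \<in> Hom D A B" for k
      using D.susp_functor AB that by (auto simp: is_functor_def)
    have c: "ArrMap (Susp D) (e B \<cdot>\<^bsub>D\<^esub> k) = e (ObjMap (Susp D) B) \<cdot>\<^bsub>D\<^esub> ArrMap (Susp D) k"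
      if "k \<in> Hom D A B" for k
      using D.susp_functor that eB e\<Sigma> AB
      by (auto simp: is_functor_def trans_commutes_susp_def Hom_def)
    have "e B \<cdot>\<^bsub>D\<^esub> f = e B \<cdot>\<^bsub>D\<^esub> ?f" using coid_relD[OF rf] by (simp add: B_def)
    then have "(ArrMap (Susp D) f, ArrMap (Susp D) ?f) \<in> coid_rel D e"
      using c[OF h(1)] c[OF h(2)] S[OF h(1)] S[OF h(2)] by (auto simp: coid_rel_def Hom_def)
    then show ?thesis by (metis coid_class_def equiv_coid_rel equiv_class_eq)
  qed
  then show ?thesis
    by (simp add: functor_eq_def comp_functor_def quotient_functor_def coidentifier_def)
qed

lemma coid_factorization:
  assumes "associated_idempotent D C G e"
  shows "functor_eq D (coid_factor G \<circ>\<^sub>F quotient_functor D e) G"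
proof -
  note nt = associated_idempotent_nat_trans(1)[OF assms]
  have fG: "is_functor D C G"
    using assms by (auto simp: associated_idempotent_def semiseparable_via_def)
  interpret D: category D using fG by (simp add: is_functor_def)
  interpret C: category C using fG by (simp add: is_functor_def)
  have "ArrMap G (rep (coid_class D e f)) = ArrMap G f" if f: "f \<in> Arr D" for f
  proof -
    let ?f = "rep (coid_class D e f)"
    have rf: "(f, ?f) \<in> coid_rel D e" using f by (rule rep_coid_class)
    define A B where "A = Dom D f" and "B = Cod D f"
    have AB: "A \<in> Obj D" "B \<in> Obj D"
      using f D.dom_obj D.cod_obj by (auto simp: A_def B_def)
    have h: "f \<in> Hom D A B" "?f \<in> Hom D A B"
      using rf by (auto simp: coid_rel_def Hom_def A_def B_def)
    have eB: "e B \<in> Hom D B B"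
      using nt AB by (auto simp: nat_trans_def id_functor_def)
    have G: "ArrMap G (e B \<cdot>\<^bsub>D\<^esub> k) = ArrMap G k" if k: "k \<in> Hom D A B" for k
    proof -
      have Gk: "ArrMap G k \<in> Hom C (ObjMap G A) (ObjMap G B)"
        using fG AB k by (simp add: is_functor_def)
      have "ArrMap G (e B \<cdot>\<^bsub>D\<^esub> k) = ArrMap G (e B) \<cdot>\<^bsub>C\<^esub> ArrMap G k"
        using fG k eB by (simp add: is_functor_def Hom_def)
      then show ?thesis
        using associated_idempotent_nat_trans(2)[OF assms AB(2)] C.ident_left[OF Gk] by simp
    qed
    have "e B \<cdot>\<^bsub>D\<^esub> f = e B \<cdot>\<^bsub>D\<^esub> ?f" using coid_relD[OF rf] by (simp add: B_def)
    then show ?thesis using G[OF h(1)] G[OF h(2)] by simp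
  qed
  then show ?thesis
    by (simp add: functor_eq_def comp_functor_def quotient_functor_def coid_factor_def)
qed

end

theory Submission
  imports Defs
begin

text \<open>
  The suspended additive structure, the splitting of idempotents and the adjunction descend from
  \<open>D\<close> to the quotient \<open>De\<close>, and on \<open>De\<close> the functor \<open>Ge\<close> is separable: \<open>P\<close> induces a natural left
  inverse of its action on arrows. Applied to the unit, this left inverse yields a natural section
  \<open>\<zeta>\<close> of the counit. Completing morphisms of triangles in \<open>De\<close> amounts to completing their images
  in \<open>C\<close> and mapping the result back. For the cone of an arrow \<open>u\<close> note that \<open>u\<close> is a retract of
  \<open>Fe (Ge u)\<close> via \<open>\<zeta>\<close>; since the monad is exact, \<open>Fe\<close> sends the triangle on \<open>Ge u\<close> to a distinguished
  one, and the two idempotents on \<open>Fe (Ge u)\<close> extend to an endomorphism of its cone which becomes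
  idempotent after a correction by a square-zero term. Splitting it gives a triangle on \<open>u\<close> that is
  a retract of a distinguished one, hence distinguished; no octahedral axiom is involved.
\<close>

section \<open>Categories and preadditive categories\<close>

text \<open>A completion \<open>h\<close> of two idempotents to a morphism of triangles is not
  unique and need not be idempotent, so the cone of a retract cannot be cut out directly. A
  nilpotency replaces uniqueness: two completions of the same pair differ by an arrow
  \<open>n\<close> with \<open>n \<cdot> v\<close> and \<open>w \<cdot> n\<close> zero; the first
  equation makes \<open>n\<close> factor through \<open>w\<close>, and the second then gives
  \<open>n \<cdot> n\<close> zero. Since \<open>h \<cdot> h\<close> and \<open>h\<close> complete
  the same pair, idempotents can be lifted modulo a square-zero term. The same fact stands in for
  the five lemma when two candidates for a cone are compared. The separability of \<open>Ge\<close>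
  comes from P(G f) = e f: this may differ from f in \<open>D\<close>, but it has the same class
  because \<open>e\<close> is idempotent. \<open>G\<close> is not assumed additive. The triangle
  axioms involve zero objects and signs, so additivity is derived from the adjunction.\<close>

context category
begin

text \<open>Composability is phrased through \<open>Dom\<close> and \<open>Cod\<close> instead of
  hom-sets, so that rewriting can discharge it without guessing objects.\<close>

lemma comp_arr [simp]:
  assumes "f \<in> Arr C" "g \<in> Arr C" "Cod C f = Dom C g"
  shows "g \<cdot> f \<in> Arr C" "Dom C (g \<cdot> f) = Dom C f" "Cod C (g \<cdot> f) = Cod C g"
  using comp_hom[of f "Dom C f" "Cod C f" g "Cod C g"] assms by (auto simp: Hom_def)

lemma ident_arr [simp]:
  assumes "A \<in> Obj C"
  shows "Ident C A \<in> Arr C" "Dom C (Ident C A) = A" "Cod C (Ident C A) = A"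
  using ident_hom[OF assms] by (auto simp: Hom_def)

lemma comp_ident [simp]:
  "\<lbrakk>f \<in> Arr C; Cod C f = A\<rbrakk> \<Longrightarrow> Ident C A \<cdot> f = f"
  "\<lbrakk>f \<in> Arr C; Dom C f = A\<rbrakk> \<Longrightarrow> f \<cdot> Ident C A = f"
  using ident_left ident_right by (auto simp: Hom_def)

lemma comp_assoc_arr:
  "\<lbrakk>f \<in> Arr C; g \<in> Arr C; h \<in> Arr C; Cod C f = Dom C g; Cod C g = Dom C h\<rbrakk>
    \<Longrightarrow> (h \<cdot> g) \<cdot> f = h \<cdot> (g \<cdot> f)"
  using comp_assoc[of f "Dom C f" "Cod C f" g "Cod C g" h "Cod C h"] by (auto simp: Hom_def)

text \<open>Makes an equation between composites applicable inside a right-associated chain.\<close>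

lemma comp_reassoc:
  assumes "g \<cdot> f = k" "f \<in> Arr C" "g \<in> Arr C" "Cod C f = Dom C g"
    and "x \<in> Arr C" "Cod C x = Dom C f"
  shows "g \<cdot> (f \<cdot> x) = k \<cdot> x"
  using comp_assoc_arr[of x f g] assms(2-) by (simp flip: assms(1))

text \<open>A left and a right inverse that arise separately agree automatically. For cones they
  come from inverting \<open>d \<cdot> c\<close> and \<open>c \<cdot> d\<close>
  independently.\<close>

lemma is_isoI:
  assumes "f \<in> Hom C A B" "g \<in> Hom C B A" "h \<in> Hom C B A"
    and "g \<cdot> f = Ident C A" "f \<cdot> h = Ident C B"
  shows "is_iso C f"
proof -
  have "g = g \<cdot> (f \<cdot> h)" using assms by (auto simp: Hom_def)
  also have "\<dots> = h" using assms comp_assoc_arr[of h f g] by (auto simp: Hom_def)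
  finally show ?thesis using assms by (auto simp: is_iso_def Hom_def)
qed

end

section \<open>Functors and natural transformations, arrow by arrow\<close>

lemma HomD:
  assumes "f \<in> Hom C A B"
  shows "f \<in> Arr C" "Dom C f = A" "Cod C f = B"
  using assms by (auto simp: Hom_def)

lemma HomI: "\<lbrakk>f \<in> Arr C; Dom C f = A; Cod C f = B\<rbrakk> \<Longrightarrow> f \<in> Hom C A B"
  by (simp add: Hom_def)

lemma functorD:
  assumes "is_functor C D F"
  shows "X \<in> Obj C \<Longrightarrow> ObjMap F X \<in> Obj D"
    and "f \<in> Arr C \<Longrightarrow> ArrMap F f \<in> Arr D"
    and "f \<in> Arr C \<Longrightarrow> Dom D (ArrMap F f) = ObjMap F (Dom C f)"
    and "f \<in> Arr C \<Longrightarrow> Cod D (ArrMap F f) = ObjMap F (Cod C f)"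
    and "X \<in> Obj C \<Longrightarrow> ArrMap F (Ident C X) = Ident D (ObjMap F X)"
    and "\<lbrakk>f \<in> Arr C; g \<in> Arr C; Cod C f = Dom C g\<rbrakk>
      \<Longrightarrow> ArrMap F (g \<cdot>\<^bsub>C\<^esub> f) = ArrMap F g \<cdot>\<^bsub>D\<^esub> ArrMap F f"
proof -
  interpret category C using assms by (simp add: is_functor_def)
  have "ArrMap F f \<in> Hom D (ObjMap F (Dom C f)) (ObjMap F (Cod C f))" if "f \<in> Arr C"
    using assms that dom_obj cod_obj unfolding is_functor_def Hom_def by blast
  then show "f \<in> Arr C \<Longrightarrow> ArrMap F f \<in> Arr D"
    and "f \<in> Arr C \<Longrightarrow> Dom D (ArrMap F f) = ObjMap F (Dom C f)"
    and "f \<in> Arr C \<Longrightarrow> Cod D (ArrMap F f) = ObjMap F (Cod C f)"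
    by (auto simp: Hom_def)
qed (use assms in \<open>simp_all add: is_functor_def\<close>)

lemma is_functorI:
  assumes "category C" "category D"
    and "\<And>X. X \<in> Obj C \<Longrightarrow> ObjMap F X \<in> Obj D"
    and "\<And>f. f \<in> Arr C \<Longrightarrow>
      ArrMap F f \<in> Hom D (ObjMap F (Dom C f)) (ObjMap F (Cod C f))"
    and "\<And>X. X \<in> Obj C \<Longrightarrow> ArrMap F (Ident C X) = Ident D (ObjMap F X)"
    and "\<And>f g. \<lbrakk>f \<in> Arr C; g \<in> Arr C; Cod C f = Dom C g\<rbrakk>
      \<Longrightarrow> ArrMap F (g \<cdot>\<^bsub>C\<^esub> f) = ArrMap F g \<cdot>\<^bsub>D\<^esub> ArrMap F f"
  shows "is_functor C D F"
  using assms unfolding is_functor_def by (auto simp: Hom_def)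

lemma functor_iso:
  assumes F: "is_functor C D F" and f: "is_iso C f"
  shows "is_iso D (ArrMap F f)"
proof -
  interpret C: category C using F by (simp add: is_functor_def)
  obtain g where g: "f \<in> Arr C" "g \<in> Hom C (Cod C f) (Dom C f)"
      "g \<cdot>\<^bsub>C\<^esub> f = Ident C (Dom C f)" "f \<cdot>\<^bsub>C\<^esub> g = Ident C (Cod C f)"
    using f by (auto simp: is_iso_def)
  note [simp] = HomD[OF g(2)] g(1)
  have "ArrMap F g \<cdot>\<^bsub>D\<^esub> ArrMap F f = ArrMap F (g \<cdot>\<^bsub>C\<^esub> f)"
    "ArrMap F f \<cdot>\<^bsub>D\<^esub> ArrMap F g = ArrMap F (f \<cdot>\<^bsub>C\<^esub> g)"
    by (simp_all add: functorD[OF F])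
  then show ?thesis
    unfolding is_iso_def
    by (intro conjI bexI[of _ "ArrMap F g"]) (simp_all add: functorD[OF F] g(3,4) C.dom_obj C.cod_obj Hom_def)
qed

lemma nat_transD:
  assumes "nat_trans C D F G \<alpha>"
  shows "X \<in> Obj C \<Longrightarrow> \<alpha> X \<in> Arr D"
    and "X \<in> Obj C \<Longrightarrow> Dom D (\<alpha> X) = ObjMap F X"
    and "X \<in> Obj C \<Longrightarrow> Cod D (\<alpha> X) = ObjMap G X"
    and "f \<in> Arr C \<Longrightarrow> \<alpha> (Cod C f) \<cdot>\<^bsub>D\<^esub> ArrMap F f = ArrMap G f \<cdot>\<^bsub>D\<^esub> \<alpha> (Dom C f)"
  using assms by (auto simp: nat_trans_def Hom_def)

section \<open>Arithmetic of arrows in a preadditive category\<close>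

context preadditive_category
begin

lemma add_arr [simp]:
  assumes "f \<in> Arr C" "g \<in> Arr C" "Dom C f = Dom C g" "Cod C f = Cod C g"
  shows "f \<oplus> g \<in> Arr C" "Dom C (f \<oplus> g) = Dom C g" "Cod C (f \<oplus> g) = Cod C g"
proof -
  interpret H: comm_group "hom_group C (Dom C g) (Cod C g)"
    using assms by (intro hom_comm_group dom_obj cod_obj)
  have "f \<oplus> g \<in> Hom C (Dom C g) (Cod C g)"
    using H.m_closed[of f g] assms by (auto simp: hom_group_def Hom_def)
  then show "f \<oplus> g \<in> Arr C" "Dom C (f \<oplus> g) = Dom C g" "Cod C (f \<oplus> g) = Cod C g"
    by (auto simp: Hom_def)
qed

lemma add_commute:
  assumes "f \<in> Arr C" "g \<in> Arr C" "Dom C f = Dom C g" "Cod C f = Cod C g"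
  shows "f \<oplus> g = g \<oplus> f"
proof -
  interpret H: comm_group "hom_group C (Dom C g) (Cod C g)"
    using assms by (intro hom_comm_group dom_obj cod_obj)
  show ?thesis using H.m_comm[of f g] assms by (auto simp: hom_group_def Hom_def)
qed

lemma add_assoc:
  assumes "f \<in> Arr C" "g \<in> Arr C" "h \<in> Arr C" "Dom C f = Dom C g" "Cod C f = Cod C g"
    "Dom C g = Dom C h" "Cod C g = Cod C h"
  shows "(f \<oplus> g) \<oplus> h = f \<oplus> (g \<oplus> h)"
proof -
  interpret H: comm_group "hom_group C (Dom C g) (Cod C g)"
    using assms by (intro hom_comm_group dom_obj cod_obj)
  show ?thesis using H.m_assoc[of f g h] assms by (auto simp: hom_group_def Hom_def)
qed

lemma add_left_commute:
  assumes "f \<in> Arr C" "g \<in> Arr C" "h \<in> Arr C" "Dom C f = Dom C g" "Cod C f = Cod C g"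
    "Dom C g = Dom C h" "Cod C g = Cod C h"
  shows "f \<oplus> (g \<oplus> h) = g \<oplus> (f \<oplus> h)"
  using add_assoc[of f g h] add_assoc[of g f h] add_commute[of f g] by (simp add: assms)

lemmas add_ac = add_commute add_assoc add_left_commute

lemma zero_arr [simp]:
  assumes "A \<in> Obj C" "B \<in> Obj C"
  shows "Zero C A B \<in> Arr C" "Dom C (Zero C A B) = A" "Cod C (Zero C A B) = B"
proof -
  interpret H: comm_group "hom_group C A B" using assms by (rule hom_comm_group)
  have "Zero C A B \<in> Hom C A B" using H.one_closed by (simp add: hom_group_def)
  then show "Zero C A B \<in> Arr C" "Dom C (Zero C A B) = A" "Cod C (Zero C A B) = B"
    by (auto simp: Hom_def)
qed

lemma add_zero [simp]:
  assumes "f \<in> Arr C" "Dom C f = A" "Cod C f = B"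
  shows "Zero C A B \<oplus> f = f" "f \<oplus> Zero C A B = f"
proof -
  interpret H: comm_group "hom_group C A B"
    using assms dom_obj cod_obj by (intro hom_comm_group) auto
  show "Zero C A B \<oplus> f = f" "f \<oplus> Zero C A B = f"
    using H.l_one[of f] H.r_one[of f] assms by (auto simp: hom_group_def Hom_def)
qed

lemma neg_arr [simp]:
  assumes "f \<in> Arr C"
  shows "Neg C f \<in> Arr C" "Dom C (Neg C f) = Dom C f" "Cod C (Neg C f) = Cod C f"
proof -
  interpret H: comm_group "hom_group C (Dom C f) (Cod C f)"
    using assms by (intro hom_comm_group dom_obj cod_obj)
  have "f \<in> carrier (hom_group C (Dom C f) (Cod C f))"
    using assms by (simp add: hom_group_def Hom_def)
  then have "Neg C f \<in> Hom C (Dom C f) (Cod C f)"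
    unfolding Neg_def using H.inv_closed[of f] by (simp add: hom_group_def)
  then show "Neg C f \<in> Arr C" "Dom C (Neg C f) = Dom C f" "Cod C (Neg C f) = Cod C f"
    by (auto simp: Hom_def)
qed

lemma add_neg [simp]:
  assumes "f \<in> Arr C"
  shows "f \<oplus> Neg C f = Zero C (Dom C f) (Cod C f)" "Neg C f \<oplus> f = Zero C (Dom C f) (Cod C f)"
proof -
  interpret H: comm_group "hom_group C (Dom C f) (Cod C f)"
    using assms by (intro hom_comm_group dom_obj cod_obj)
  have "f \<in> carrier (hom_group C (Dom C f) (Cod C f))"
    using assms by (simp add: hom_group_def Hom_def)
  from H.r_inv[OF this] H.l_inv[OF this]
  show "f \<oplus> Neg C f = Zero C (Dom C f) (Cod C f)" "Neg C f \<oplus> f = Zero C (Dom C f) (Cod C f)"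
    unfolding Neg_def by (simp_all add: hom_group_def)
qed

lemma add_neg_cancel [simp]:
  assumes "f \<in> Arr C" "g \<in> Arr C" "Dom C f = Dom C g" "Cod C f = Cod C g"
  shows "f \<oplus> (Neg C f \<oplus> g) = g" "Neg C f \<oplus> (f \<oplus> g) = g"
  using add_assoc[of f "Neg C f" g] add_assoc[of "Neg C f" f g] by (simp_all add: assms)

lemma add_left_cancel:
  assumes "f \<in> Arr C" "g \<in> Arr C" "h \<in> Arr C" "Dom C f = Dom C g" "Cod C f = Cod C g"
    "Dom C h = Dom C g" "Cod C h = Cod C g" "f \<oplus> g = f \<oplus> h"
  shows "g = h"
proof -
  have "g = Neg C f \<oplus> (f \<oplus> g)" by (rule add_neg_cancel(2)[symmetric]) (use assms in auto)
  also have "\<dots> = Neg C f \<oplus> (f \<oplus> h)" by (simp only: assms(8))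
  also have "\<dots> = h" by (rule add_neg_cancel(2)) (use assms in auto)
  finally show ?thesis .
qed

lemma neg_unique:
  assumes "f \<in> Arr C" "g \<in> Arr C" "Dom C f = Dom C g" "Cod C f = Cod C g"
    and "f \<oplus> g = Zero C (Dom C g) (Cod C g)"
  shows "g = Neg C f"
  using assms by (intro add_left_cancel[of f g "Neg C f"]) auto

lemma neg_neg [simp]: "f \<in> Arr C \<Longrightarrow> Neg C (Neg C f) = f"
  by (rule neg_unique[symmetric]) auto

lemma distrib [simp]:
  assumes "f \<in> Arr C" "g \<in> Arr C" "h \<in> Arr C"
  shows "\<lbrakk>Dom C g = Dom C h; Cod C g = Cod C h; Cod C f = Dom C h\<rbrakk>
      \<Longrightarrow> (g \<oplus> h) \<cdot> f = (g \<cdot> f) \<oplus> (h \<cdot> f)"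
    and "\<lbrakk>Dom C g = Dom C h; Cod C g = Cod C h; Cod C h = Dom C f\<rbrakk>
      \<Longrightarrow> f \<cdot> (g \<oplus> h) = (f \<cdot> g) \<oplus> (f \<cdot> h)"
  using assms comp_add_left comp_add_right by (auto simp: Hom_def)

lemma zero_comp [simp]:
  assumes f: "f \<in> Arr C"
  shows "\<lbrakk>Cod C f = A; B \<in> Obj C\<rbrakk> \<Longrightarrow> Zero C A B \<cdot> f = Zero C (Dom C f) B"
    and "\<lbrakk>Dom C f = B; A \<in> Obj C\<rbrakk> \<Longrightarrow> f \<cdot> Zero C A B = Zero C A (Cod C f)"
proof -
  note [simp] = f dom_obj cod_obj
  assume [simp]: "B \<in> Obj C" and A: "Cod C f = A"
  have [simp]: "A \<in> Obj C" using A f cod_obj by auto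
  have "Zero C A B \<cdot> f \<oplus> Zero C A B \<cdot> f = (Zero C A B \<oplus> Zero C A B) \<cdot> f"
    using A by (subst distrib(1)) auto
  also have "\<dots> = Zero C A B \<cdot> f \<oplus> Zero C (Dom C f) B"
    using A by simp
  finally show "Zero C A B \<cdot> f = Zero C (Dom C f) B"
    using A by (intro add_left_cancel[of "Zero C A B \<cdot> f" _ "Zero C (Dom C f) B"]) auto
next
  note [simp] = f dom_obj cod_obj
  assume [simp]: "A \<in> Obj C" and B: "Dom C f = B"
  have [simp]: "B \<in> Obj C" using B f dom_obj by auto
  have "f \<cdot> Zero C A B \<oplus> f \<cdot> Zero C A B = f \<cdot> (Zero C A B \<oplus> Zero C A B)"
    using B by (subst distrib(2)) auto
  also have "\<dots> = f \<cdot> Zero C A B \<oplus> Zero C A (Cod C f)"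
    using B by simp
  finally show "f \<cdot> Zero C A B = Zero C A (Cod C f)"
    using B by (intro add_left_cancel[of "f \<cdot> Zero C A B" _ "Zero C A (Cod C f)"]) auto
qed

lemma neg_comp [simp]:
  assumes [simp]: "f \<in> Arr C" "g \<in> Arr C" "Cod C f = Dom C g"
  shows "Neg C g \<cdot> f = Neg C (g \<cdot> f)" "g \<cdot> Neg C f = Neg C (g \<cdot> f)"
proof -
  have [simp]: "Dom C f \<in> Obj C" "Cod C g \<in> Obj C" by (simp_all add: dom_obj cod_obj)
  have "g \<cdot> f \<oplus> Neg C g \<cdot> f = (g \<oplus> Neg C g) \<cdot> f" by (subst distrib(1)) auto
  then show "Neg C g \<cdot> f = Neg C (g \<cdot> f)" by (intro neg_unique) auto
  have "g \<cdot> f \<oplus> g \<cdot> Neg C f = g \<cdot> (f \<oplus> Neg C f)" by (subst distrib(2)) auto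
  then show "g \<cdot> Neg C f = Neg C (g \<cdot> f)" by (intro neg_unique) auto
qed

lemma neg_zero [simp]: "\<lbrakk>A \<in> Obj C; B \<in> Obj C\<rbrakk> \<Longrightarrow> Neg C (Zero C A B) = Zero C A B"
  by (rule neg_unique[symmetric]) auto

lemma zero_object_hom:
  assumes "zero_object C Z" "f \<in> Arr C"
  shows "Cod C f = Z \<Longrightarrow> f = Zero C (Dom C f) Z" "Dom C f = Z \<Longrightarrow> f = Zero C Z (Cod C f)"
proof -
  have Z: "Z \<in> Obj C" using assms by (simp add: zero_object_def)
  { assume "Cod C f = Z"
    then have "f \<in> Hom C (Dom C f) Z" "Zero C (Dom C f) Z \<in> Hom C (Dom C f) Z"
      using assms Z dom_obj by (auto simp: Hom_def)
    moreover have "\<exists>!g. g \<in> Hom C (Dom C f) Z"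
      using assms dom_obj by (simp add: zero_object_def)
    ultimately show "f = Zero C (Dom C f) Z" by blast }
  { assume "Dom C f = Z"
    then have "f \<in> Hom C Z (Cod C f)" "Zero C Z (Cod C f) \<in> Hom C Z (Cod C f)"
      using assms Z cod_obj by (auto simp: Hom_def)
    moreover have "\<exists>!g. g \<in> Hom C Z (Cod C f)"
      using assms cod_obj by (simp add: zero_object_def)
    ultimately show "f = Zero C Z (Cod C f)" by blast }
qed

text \<open>An arrow into or out of \<open>Z\<close> absorbs the identity of \<open>Z\<close>, so it
  vanishes with it. This reduces a uniqueness statement to one equation, which functors can
  transport.\<close>

lemma zero_objectI:
  assumes Z: "Z \<in> Obj C" and id: "Ident C Z = Zero C Z Z"
  shows "zero_object C Z"
  unfolding zero_object_def
proof (intro conjI ballI ex1I)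
  fix X assume X: "X \<in> Obj C"
  show "Zero C X Z \<in> Hom C X Z" "Zero C Z X \<in> Hom C Z X" using X Z by (auto simp: Hom_def)
  show "f = Zero C X Z" if "f \<in> Hom C X Z" for f
    using that Z id comp_ident(1)[of f Z] zero_comp(1)[of f Z Z] by (auto simp: Hom_def)
  show "f = Zero C Z X" if "f \<in> Hom C Z X" for f
    using that Z id comp_ident(2)[of f Z] zero_comp(2)[of f Z Z] by (auto simp: Hom_def)
qed (rule Z)

text \<open>With \<open>n = h\<^sup>2 - h\<close> and \<open>n\<^sup>2 = 0\<close>, the arrow \<open>h + n - 2hn = 3h\<^sup>2 - 2h\<^sup>3\<close> is idempotent.\<close>

lemma idempotent_lift:
  assumes h: "h \<in> Hom C Z Z" and Z: "Z \<in> Obj C"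
    and nil: "(h \<cdot> h \<oplus> Neg C h) \<cdot> (h \<cdot> h \<oplus> Neg C h) = Zero C Z Z"
  obtains k where "k \<in> Hom C Z Z" "k \<cdot> k = k"
    and "\<And>Y v q. \<lbrakk>v \<in> Hom C Y Z; q \<in> Hom C Y Y; q \<cdot> q = q; h \<cdot> v = v \<cdot> q\<rbrakk> \<Longrightarrow> k \<cdot> v = v \<cdot> q"
    and "\<And>X w p. \<lbrakk>w \<in> Hom C Z X; p \<in> Hom C X X; p \<cdot> p = p; w \<cdot> h = p \<cdot> w\<rbrakk> \<Longrightarrow> w \<cdot> k = p \<cdot> w"
proof -
  note [simp] = HomD[OF h] Z
  define n where "n = h \<cdot> h \<oplus> Neg C h"
  have [simp]: "n \<in> Arr C" "Dom C n = Z" "Cod C n = Z" by (simp_all add: n_def)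
  have hh: "h \<cdot> h = h \<oplus> n"
    by (simp add: n_def add_ac)
  have nn: "n \<cdot> n = Zero C Z Z" using nil by (simp add: n_def)
  have nh: "n \<cdot> h = h \<cdot> n"
    by (simp add: n_def comp_assoc_arr)
  define m where "m = h \<cdot> n"
  have [simp]: "m \<in> Arr C" "Dom C m = Z" "Cod C m = Z" by (simp_all add: m_def)
  have prods: "n \<cdot> h = m" "h \<cdot> n = m" "n \<cdot> n = Zero C Z Z" "h \<cdot> h = h \<oplus> n"
    using nn hh nh by (simp_all add: m_def)
  have hm: "h \<cdot> m = m"
    unfolding m_def using comp_assoc_arr[of n h h, symmetric] by (simp add: hh nn)
  have nm: "n \<cdot> m = Zero C Z Z"
    unfolding m_def using comp_assoc_arr[of n h n, symmetric] by (simp add: nh comp_assoc_arr nn)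
  have mh: "m \<cdot> h = m"
    using hm by (simp add: m_def comp_assoc_arr nh)
  have mn: "m \<cdot> n = Zero C Z Z" by (simp add: m_def comp_assoc_arr nn)
  have mm: "m \<cdot> m = Zero C Z Z"
    using comp_assoc_arr[of m n h] by (simp add: m_def[symmetric] nm)
  \<comment> \<open>One Newton step for x^2 - x starting at \<open>h\<close>, namely h - n (2h -
    1)^(-1). Because (2h - 1)^2 = 1 + 4n and n^2 = 0, the inverse may be replaced by 2h - 1, which
    gives h + n - 2hn.\<close>
  define k where "k = h \<oplus> (n \<oplus> (Neg C m \<oplus> Neg C m))"
  have "k \<in> Hom C Z Z" by (simp add: k_def Hom_def)
  moreover have "k \<cdot> k = k"
    by (simp add: k_def prods hm nm mh mn mm add_ac)
  moreover have "k \<cdot> v = v \<cdot> q"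
    if v: "v \<in> Hom C Y Z" and q: "q \<in> Hom C Y Y" "q \<cdot> q = q" "h \<cdot> v = v \<cdot> q" for Y v q
  proof -
    note [simp] = HomD[OF v] HomD[OF q(1)]
    have Y [simp]: "Y \<in> Obj C" using dom_obj[of v] by simp
    \<comment> \<open>On \<open>v\<close> the arrow \<open>h\<close> acts through the idempotent
      \<open>q\<close>, so \<open>n \<cdot> v\<close> is zero; every term of k - h ends in
      \<open>n\<close> on the right, so \<open>k\<close> acts on \<open>v\<close> as
      \<open>h\<close> does. The case of \<open>w\<close> is dual.\<close>
    have "h \<cdot> (h \<cdot> v) = v \<cdot> (q \<cdot> q)"
      using q(3) comp_assoc_arr[of q v h] comp_assoc_arr[of q q v] by simp
    then have nv: "n \<cdot> v = Zero C Y Z" by (simp add: n_def q comp_assoc_arr)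
    show ?thesis by (simp add: k_def m_def comp_assoc_arr nv q(3))
  qed
  moreover have "w \<cdot> k = p \<cdot> w"
    if w: "w \<in> Hom C Z X" and p: "p \<in> Hom C X X" "p \<cdot> p = p" "w \<cdot> h = p \<cdot> w" for X w p
  proof -
    note [simp] = HomD[OF w] HomD[OF p(1)]
    have X [simp]: "X \<in> Obj C" using cod_obj[of w] by simp
    have "w \<cdot> (h \<cdot> h) = p \<cdot> w"
      using p comp_assoc_arr[of h h w] comp_assoc_arr[of h w p] comp_assoc_arr[of w p p] by simp
    then have wn: "w \<cdot> n = Zero C Z X" by (simp add: n_def p(3))
    have "w \<cdot> m = Zero C Z X"
      using comp_assoc_arr[of n h w] comp_assoc_arr[of n w p] by (simp add: m_def p(3) wn)
    then show ?thesis by (simp add: k_def wn p(3))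
  qed
  ultimately show thesis by (rule that) blast+
qed

text \<open>If x = 1 + m with m^2 = 0, then 1 - m is a two-sided inverse.\<close>

lemma unipotent_invertible:
  assumes x: "x \<in> Hom C A A" and A: "A \<in> Obj C"
    and nil: "(x \<oplus> Neg C (Ident C A)) \<cdot> (x \<oplus> Neg C (Ident C A)) = Zero C A A"
  obtains y where "y \<in> Hom C A A" "y \<cdot> x = Ident C A" "x \<cdot> y = Ident C A"
proof -
  note [simp] = HomD[OF x] A
  define m where "m = x \<oplus> Neg C (Ident C A)"
  have [simp]: "m \<in> Arr C" "Dom C m = A" "Cod C m = A" by (simp_all add: m_def)
  have x_eq: "x = Ident C A \<oplus> m" by (simp add: m_def add_ac)
  have mm: "m \<cdot> m = Zero C A A" using nil by (simp add: m_def)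
  show thesis
  proof
    show "Ident C A \<oplus> Neg C m \<in> Hom C A A" by (simp add: Hom_def)
    show "(Ident C A \<oplus> Neg C m) \<cdot> x = Ident C A" "x \<cdot> (Ident C A \<oplus> Neg C m) = Ident C A"
      by (simp_all add: x_eq mm add_ac)
  qed
qed

end

section \<open>Retracts of distinguished triangles\<close>

context suspended_category
begin

lemma susp_simps [simp]:
  "X \<in> Obj C \<Longrightarrow> ObjMap (Susp C) X \<in> Obj C"
  "f \<in> Arr C \<Longrightarrow> ArrMap (Susp C) f \<in> Arr C"
  "f \<in> Arr C \<Longrightarrow> Dom C (ArrMap (Susp C) f) = ObjMap (Susp C) (Dom C f)"
  "f \<in> Arr C \<Longrightarrow> Cod C (ArrMap (Susp C) f) = ObjMap (Susp C) (Cod C f)"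
  "X \<in> Obj C \<Longrightarrow> ArrMap (Susp C) (Ident C X) = Ident C (ObjMap (Susp C) X)"
  "\<lbrakk>f \<in> Arr C; g \<in> Arr C; Cod C f = Dom C g\<rbrakk>
    \<Longrightarrow> ArrMap (Susp C) (g \<cdot> f) = ArrMap (Susp C) g \<cdot> ArrMap (Susp C) f"
  using functorD[OF susp_functor] by auto

lemma ex_desuspension:
  assumes "A \<in> Obj C"
  obtains B where "B \<in> Obj C" "ObjMap (Susp C) B = A"
proof -
  obtain S where "is_functor C C S" "functor_eq C (Susp C \<circ>\<^sub>F S) id_functor"
    using susp_invertible by auto
  then show thesis
    using that[of "ObjMap S A"] assms functorD(1)[of C C S A]
    by (simp add: functor_eq_def comp_functor_def id_functor_def)
qed

end

lemma triangleD:
  assumes "(u, v, w) \<in> triangles C"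
  shows "u \<in> Arr C" "v \<in> Arr C" "w \<in> Arr C"
    "Cod C u = Dom C v" "Cod C v = Dom C w" "Cod C w = ObjMap (Susp C) (Dom C u)"
  using assms by (auto simp: triangles_def)

context pretriangulated_category
begin

text \<open>The arrow \<open>f\<close>, together with a zero arrow, maps the rotated triangle to a
  trivial triangle on \<open>A\<close>; the third component of its completion is the factorization
  through \<open>w\<close>.\<close>

lemma weak_cokernel:
  assumes t: "(u, v, w) \<in> \<Delta>" and f: "f \<in> Arr C" "Dom C f = Cod C v"
    and fv: "f \<cdot> v = Zero C (Dom C v) (Cod C f)"
  obtains g where "g \<in> Arr C" "Dom C g = Cod C w" "Cod C g = Cod C f" "g \<cdot> w = f"
proof -
  have tT: "(u, v, w) \<in> triangles C" using t distinguished_triangles by auto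
  note [simp] = triangleD[OF tT]
  define A where "A = Cod C f"
  have A [simp]: "A \<in> Obj C" and fA [simp]: "Cod C f = A"
    using f cod_obj by (auto simp: A_def)
  obtain Z where Z: "zero_object C Z" using ex_zero_object by auto
  then have [simp]: "Z \<in> Obj C" by (simp add: zero_object_def)
  \<comment> \<open>Rotating the trivial triangle on \<open>A\<close> backwards needs a first object
    whose suspension is exactly the zero object \<open>Z\<close>.\<close>
  obtain Y where Y [simp]: "Y \<in> Obj C" "ObjMap (Susp C) Y = Z"
    using ex_desuspension[of Z] by auto
  have "Neg C (ArrMap (Susp C) (Zero C Y A)) = Zero C Z (ObjMap (Susp C) A)"
    using zero_object_hom(2)[OF Z, of "Neg C (ArrMap (Susp C) (Zero C Y A))"] by simp
  then have "(Neg C (Neg C (Ident C A)), Neg C (Zero C A Z), Neg C (ArrMap (Susp C) (Zero C Y A))) \<in> \<Delta>"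
    using ident_distinguished[OF A Z] by simp
  then have 0: "(Zero C Y A, Neg C (Ident C A), Zero C A Z) \<in> \<Delta>"
    by (subst rotate) (simp_all add: triangles_def)
  have 1: "(Neg C v, Neg C w, Neg C (ArrMap (Susp C) u)) \<in> \<Delta>"
    using t rotate[OF tT] by simp
  have [simp]: "Dom C v \<in> Obj C" by (simp add: dom_obj)
  obtain g where g: "triangle_map C (Neg C v, Neg C w, Neg C (ArrMap (Susp C) u))
      (Zero C Y A, Neg C (Ident C A), Zero C A Z) (Zero C (Dom C v) Y) f g"
    using ex_completion[OF 1 0, of "Zero C (Dom C v) Y" f] f fv by (auto simp: Hom_def)
  then have [simp]: "g \<in> Arr C" "Dom C g = Cod C w" "Cod C g = A" and "g \<cdot> Neg C w = Neg C (Ident C A) \<cdot> f"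
    by (simp_all add: Hom_def)
  then have "Neg C (g \<cdot> w) = Neg C f" using f by simp
  then have "Neg C (Neg C (g \<cdot> w)) = Neg C (Neg C f)" by simp
  then show thesis using that[of g] f by simp
qed

text \<open>From \<open>n \<cdot> v\<close> zero, n = g w for some g, and then n n = g (w n) = 0.
  This applies to the difference of any two completions of the same pair of arrows.\<close>

lemma square_zero:
  assumes t: "(u, v, w) \<in> \<Delta>" and n: "n \<in> Arr C" "Dom C n = Dom C w" "Cod C n = Dom C w"
    and nv: "n \<cdot> v = Zero C (Dom C v) (Dom C w)" and wn: "w \<cdot> n = Zero C (Dom C w) (Cod C w)"
  shows "n \<cdot> n = Zero C (Dom C w) (Dom C w)"
proof -
  have tT: "(u, v, w) \<in> triangles C" using t distinguished_triangles by auto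
  note [simp] = triangleD[OF tT] n
  obtain g where g: "g \<in> Arr C" "Dom C g = Cod C w" "Cod C g = Dom C w" "g \<cdot> w = n"
    using weak_cokernel[OF t, of n] nv by auto
  have [simp]: "Dom C w \<in> Obj C" by (simp add: dom_obj)
  have "n \<cdot> n = g \<cdot> (w \<cdot> n)" using g by (simp add: comp_assoc_arr flip: g(4))
  then show ?thesis using g by (simp add: wn)
qed

text \<open>The cone of \<open>u\<close> is compared with the third object of the retract by \<open>c\<close> and \<open>d\<close>. Both
  \<open>dc - 1\<close> and \<open>cd - 1\<close> square to zero, the latter because it extends by zero to an endomorphism of
  the given distinguished triangle.\<close>

lemma retract_distinguished:
  assumes t: "(u, v, w) \<in> triangles C" and T: "(U, V, W) \<in> \<Delta>"
    and inc: "triangle_map C (u, v, w) (U, V, W) i j k"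
    and proj: "triangle_map C (U, V, W) (u, v, w) p q r"
    and ret: "p \<cdot> i = Ident C (Dom C u)" "q \<cdot> j = Ident C (Dom C v)" "r \<cdot> k = Ident C (Dom C w)"
  shows "(u, v, w) \<in> \<Delta>"
proof -
  have TT: "(U, V, W) \<in> triangles C" using T distinguished_triangles by auto
  note [simp] = triangleD[OF t] triangleD[OF TT]
  obtain v0 w0 where t0: "(u, v0, w0) \<in> \<Delta>" using ex_distinguished[of u] by auto
  then have tT0: "(u, v0, w0) \<in> triangles C" using distinguished_triangles by auto
  note [simp] = triangleD(2,3,5,6)[OF tT0]
  have [simp]: "Dom C v0 = Dom C v" using triangleD(4)[OF tT0] by simp
  have i [simp]: "i \<in> Arr C" "Dom C i = Dom C u" "Cod C i = Dom C U"
    and j [simp]: "j \<in> Arr C" "Dom C j = Dom C v" "Cod C j = Dom C V"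
    and k [simp]: "k \<in> Arr C" "Dom C k = Dom C w" "Cod C k = Dom C W"
    and inc_eq: "j \<cdot> u = U \<cdot> i" "k \<cdot> v = V \<cdot> j" "ArrMap (Susp C) i \<cdot> w = W \<cdot> k"
    using inc by (simp_all add: Hom_def)
  have p [simp]: "p \<in> Arr C" "Dom C p = Dom C U" "Cod C p = Dom C u"
    and q [simp]: "q \<in> Arr C" "Dom C q = Dom C V" "Cod C q = Dom C v"
    and r [simp]: "r \<in> Arr C" "Dom C r = Dom C W" "Cod C r = Dom C w"
    and proj_eq: "q \<cdot> U = u \<cdot> p" "r \<cdot> V = v \<cdot> q" "ArrMap (Susp C) p \<cdot> W = w \<cdot> r"
    using proj by (simp_all add: Hom_def)
  have objs [simp]: "Dom C u \<in> Obj C" "Dom C v \<in> Obj C" "Dom C w \<in> Obj C" "Dom C w0 \<in> Obj C"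
    "Dom C V \<in> Obj C" "Dom C W \<in> Obj C"
    by (simp_all add: dom_obj)
  obtain a where "triangle_map C (u, v0, w0) (U, V, W) i j a"
    using ex_completion[OF t0 T, of i j] inc_eq by (auto simp: Hom_def)
  then have a [simp]: "a \<in> Arr C" "Dom C a = Dom C w0" "Cod C a = Dom C W"
    and a_eq: "a \<cdot> v0 = V \<cdot> j" "ArrMap (Susp C) i \<cdot> w0 = W \<cdot> a"
    by (simp_all add: Hom_def)
  obtain b where "triangle_map C (U, V, W) (u, v0, w0) p q b"
    using ex_completion[OF T t0, of p q] proj_eq by (auto simp: Hom_def)
  then have b [simp]: "b \<in> Arr C" "Dom C b = Dom C W" "Cod C b = Dom C w0"
    and b_eq: "b \<cdot> V = v0 \<cdot> q" "ArrMap (Susp C) p \<cdot> W = w0 \<cdot> b"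
    by (simp_all add: Hom_def)
  \<comment> \<open>As \<open>p \<cdot> i\<close> and \<open>q \<cdot> j\<close> are identities,
    \<open>c\<close> and \<open>d\<close> lie over the identities of the first two objects:
    \<open>c \<cdot> v0 = v\<close>, \<open>w \<cdot> c = w0\<close>, and likewise for
    \<open>d\<close>. They need not be inverse to each other.\<close>
  define c where "c = r \<cdot> a"
  define d where "d = b \<cdot> k"
  have c [simp]: "c \<in> Arr C" "Dom C c = Dom C w0" "Cod C c = Dom C w" by (simp_all add: c_def)
  have d [simp]: "d \<in> Arr C" "Dom C d = Dom C w" "Cod C d = Dom C w0" by (simp_all add: d_def)
  have Sret: "ArrMap (Susp C) p \<cdot> ArrMap (Susp C) i = Ident C (ObjMap (Susp C) (Dom C u))"
    using arg_cong[OF ret(1), of "ArrMap (Susp C)"] by simp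
  note re = comp_reassoc[OF inc_eq(2)] comp_reassoc[OF proj_eq(2)] comp_reassoc[OF a_eq(1)]
    comp_reassoc[OF b_eq(1)] comp_reassoc[OF ret(2)] comp_reassoc[OF ret(3)] comp_assoc_arr
  have cv: "c \<cdot> v0 = v" by (simp add: c_def a_eq re ret)
  have dv: "d \<cdot> v = v0" by (simp add: d_def inc_eq re ret)
  have wc: "w \<cdot> c = w0"
  proof -
    have "w \<cdot> c = (w \<cdot> r) \<cdot> a" by (simp add: c_def comp_assoc_arr)
    also have "\<dots> = ArrMap (Susp C) p \<cdot> (W \<cdot> a)" by (simp add: comp_assoc_arr flip: proj_eq(3))
    also have "\<dots> = (ArrMap (Susp C) p \<cdot> ArrMap (Susp C) i) \<cdot> w0"
      by (simp add: comp_assoc_arr a_eq(2))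
    finally show ?thesis by (simp add: Sret)
  qed
  have wd: "w0 \<cdot> d = w"
  proof -
    have "w0 \<cdot> d = (w0 \<cdot> b) \<cdot> k" by (simp add: d_def comp_assoc_arr)
    also have "\<dots> = ArrMap (Susp C) p \<cdot> (W \<cdot> k)" by (simp add: comp_assoc_arr flip: b_eq(2))
    also have "\<dots> = (ArrMap (Susp C) p \<cdot> ArrMap (Susp C) i) \<cdot> w"
      by (simp add: comp_assoc_arr inc_eq(3))
    finally show ?thesis by (simp add: Sret)
  qed
  define m where "m = d \<cdot> c \<oplus> Neg C (Ident C (Dom C w0))"
  define n where "n = c \<cdot> d \<oplus> Neg C (Ident C (Dom C w))"
  have [simp]: "m \<in> Arr C" "Dom C m = Dom C w0" "Cod C m = Dom C w0" by (simp_all add: m_def)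
  have [simp]: "n \<in> Arr C" "Dom C n = Dom C w" "Cod C n = Dom C w" by (simp_all add: n_def)
  have "m \<cdot> m = Zero C (Dom C w0) (Dom C w0)"
    using comp_reassoc[OF wd, of c]
    by (intro square_zero[OF t0]) (simp_all add: m_def comp_assoc_arr cv dv wc)
  then obtain y where y: "y \<in> Hom C (Dom C w0) (Dom C w0)" "y \<cdot> (d \<cdot> c) = Ident C (Dom C w0)"
    using unipotent_invertible[of "d \<cdot> c" "Dom C w0"] by (auto simp: Hom_def m_def)
  have nv: "n \<cdot> v = Zero C (Dom C v) (Dom C w)"
    by (simp add: n_def comp_assoc_arr cv dv)
  have wn: "w \<cdot> n = Zero C (Dom C w) (Cod C w)"
    using comp_reassoc[OF wc, of d] by (simp add: n_def wd)
  \<comment> \<open>\<open>square_zero\<close> asks for a distinguished triangle, which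
    \<open>(u, v, w)\<close> is not yet known to be. So \<open>n\<close> is moved to the third
    object of \<open>(U, V, W)\<close>; because \<open>r \<cdot> k\<close> is the identity,
    \<open>n \<cdot> n\<close> is recovered from \<open>N \<cdot> N\<close>.\<close>
  define N where "N = k \<cdot> (n \<cdot> r)"
  have [simp]: "N \<in> Arr C" "Dom C N = Dom C W" "Cod C N = Dom C W" by (simp_all add: N_def)
  have "N \<cdot> V = Zero C (Dom C V) (Dom C W)"
    by (simp add: N_def comp_assoc_arr proj_eq(2) comp_reassoc[OF nv])
  moreover have "W \<cdot> N = Zero C (Dom C W) (Cod C W)"
  proof -
    have "W \<cdot> N = (W \<cdot> k) \<cdot> (n \<cdot> r)" by (simp add: N_def comp_assoc_arr)
    also have "\<dots> = ArrMap (Susp C) i \<cdot> (w \<cdot> (n \<cdot> r))"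
      by (simp add: comp_assoc_arr flip: inc_eq(3))
    finally show ?thesis by (simp add: comp_reassoc[OF wn])
  qed
  ultimately have NN: "N \<cdot> N = Zero C (Dom C W) (Dom C W)"
    by (intro square_zero[OF T]) simp_all
  have "n \<cdot> n = r \<cdot> ((N \<cdot> N) \<cdot> k)"
    by (simp add: N_def comp_assoc_arr ret(3) comp_reassoc[OF ret(3)])
  then have "n \<cdot> n = Zero C (Dom C w) (Dom C w)" by (simp add: NN)
  then obtain z where z: "z \<in> Hom C (Dom C w) (Dom C w)" "(c \<cdot> d) \<cdot> z = Ident C (Dom C w)"
    using unipotent_invertible[of "c \<cdot> d" "Dom C w"] by (auto simp: Hom_def n_def)
  note [simp] = HomD[OF y(1)] HomD[OF z(1)]
  have "is_iso C c"
    by (rule is_isoI[of c "Dom C w0" "Dom C w" "y \<cdot> d" "d \<cdot> z"])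
      (use y(2) z(2) in \<open>simp_all add: Hom_def comp_assoc_arr\<close>)
  moreover have "is_iso C (Ident C A)" if "A \<in> Obj C" for A
    using that by (intro is_isoI[of _ A A "Ident C A" "Ident C A"]) (simp_all add: Hom_def)
  ultimately have "triangle_iso C (u, v0, w0) (u, v, w)"
    unfolding triangle_iso_def
    by (intro exI[of _ "Ident C (Dom C u)"] exI[of _ "Ident C (Dom C v)"] exI[of _ c])
      (simp add: Hom_def cv wc)
  then show ?thesis using iso_closed[OF t0 t] by simp
qed

end

section \<open>Right adjoints are additive\<close>

lemma adjunctionD:
  assumes "adjunction C D F G \<eta> \<epsilon>"
  shows "is_functor C D F" "is_functor D C G"
    "nat_trans C C id_functor (G \<circ>\<^sub>F F) \<eta>" "nat_trans D D (F \<circ>\<^sub>F G) id_functor \<epsilon>"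
    "X \<in> Obj C \<Longrightarrow> \<epsilon> (ObjMap F X) \<cdot>\<^bsub>D\<^esub> ArrMap F (\<eta> X) = Ident D (ObjMap F X)"
    "Y \<in> Obj D \<Longrightarrow> ArrMap G (\<epsilon> Y) \<cdot>\<^bsub>C\<^esub> \<eta> (ObjMap G Y) = Ident C (ObjMap G Y)"
  using assms unfolding adjunction_def by blast+

lemma adjunction_simps:
  assumes "adjunction C D F G \<eta> \<epsilon>"
  shows "X \<in> Obj C \<Longrightarrow> \<eta> X \<in> Arr C" "X \<in> Obj C \<Longrightarrow> Dom C (\<eta> X) = X"
    "X \<in> Obj C \<Longrightarrow> Cod C (\<eta> X) = ObjMap G (ObjMap F X)"
    "f \<in> Arr C \<Longrightarrow> ArrMap G (ArrMap F f) \<cdot>\<^bsub>C\<^esub> \<eta> (Dom C f) = \<eta> (Cod C f) \<cdot>\<^bsub>C\<^esub> f"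
    "Y \<in> Obj D \<Longrightarrow> \<epsilon> Y \<in> Arr D" "Y \<in> Obj D \<Longrightarrow> Cod D (\<epsilon> Y) = Y"
    "Y \<in> Obj D \<Longrightarrow> Dom D (\<epsilon> Y) = ObjMap F (ObjMap G Y)"
    "g \<in> Arr D \<Longrightarrow> \<epsilon> (Cod D g) \<cdot>\<^bsub>D\<^esub> ArrMap F (ArrMap G g) = g \<cdot>\<^bsub>D\<^esub> \<epsilon> (Dom D g)"
  using nat_transD[OF adjunctionD(3)[OF assms]] nat_transD[OF adjunctionD(4)[OF assms]]
  by (simp_all add: id_functor_def comp_functor_def)

text \<open>An arrow into \<open>G Y\<close> is recovered from its transpose by applying
  \<open>G\<close> and precomposing with the unit, by naturality of \<open>\<eta>\<close> and a
  triangle identity.\<close>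

lemma transpose_inject:
  assumes adj: "adjunction C D F G \<eta> \<epsilon>" and Y: "Y \<in> Obj D"
    and a: "a \<in> Hom C X (ObjMap G Y)" and b: "b \<in> Hom C X (ObjMap G Y)"
    and eq: "\<epsilon> Y \<cdot>\<^bsub>D\<^esub> ArrMap F a = \<epsilon> Y \<cdot>\<^bsub>D\<^esub> ArrMap F b"
  shows "a = b"
proof -
  note F = adjunctionD(1)[OF adj] and G = adjunctionD(2)[OF adj]
  interpret C: category C using F by (simp add: is_functor_def)
  interpret D: category D using F by (simp add: is_functor_def)
  have X: "X \<in> Obj C" using a C.dom_obj by (auto simp: Hom_def)
  have "x = ArrMap G (\<epsilon> Y \<cdot>\<^bsub>D\<^esub> ArrMap F x) \<cdot>\<^bsub>C\<^esub> \<eta> X" if x: "x \<in> Hom C X (ObjMap G Y)" for x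
  proof -
    note [simp] = HomD[OF x] X Y functorD[OF F] functorD[OF G] adjunction_simps(1-3,5-7)[OF adj]
    have "ArrMap G (\<epsilon> Y \<cdot>\<^bsub>D\<^esub> ArrMap F x) \<cdot>\<^bsub>C\<^esub> \<eta> X
        = ArrMap G (\<epsilon> Y) \<cdot>\<^bsub>C\<^esub> (ArrMap G (ArrMap F x) \<cdot>\<^bsub>C\<^esub> \<eta> X)"
      by (simp add: C.comp_assoc_arr)
    also have "\<dots> = (ArrMap G (\<epsilon> Y) \<cdot>\<^bsub>C\<^esub> \<eta> (ObjMap G Y)) \<cdot>\<^bsub>C\<^esub> x"
      using adjunction_simps(4)[OF adj, of x] by (simp add: C.comp_assoc_arr)
    finally show ?thesis by (simp add: adjunctionD(6)[OF adj Y])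
  qed
  from this[OF a] this[OF b] show ?thesis by (simp add: eq)
qed

text \<open>All arrows from \<open>G Z\<close> to itself have the same transpose, an arrow into a
  zero object, so the identity equals zero. A zero arrow is then preserved because it factors
  through a zero object.\<close>

lemma right_adjoint_zero:
  assumes C: "preadditive_category C" and D: "additive_category D"
    and adj: "adjunction C D F G \<eta> \<epsilon>"
  shows "zero_object D Z \<Longrightarrow> zero_object C (ObjMap G Z)"
    and "\<lbrakk>A \<in> Obj D; B \<in> Obj D\<rbrakk> \<Longrightarrow> ArrMap G (Zero D A B) = Zero C (ObjMap G A) (ObjMap G B)"
proof -
  interpret C: preadditive_category C by (rule C)
  interpret D: additive_category D by (rule D)
  note F = adjunctionD(1)[OF adj] and G = adjunctionD(2)[OF adj]
  note [simp] = functorD[OF F] functorD[OF G] adjunction_simps(1-3,5-7)[OF adj]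
  have zero: "zero_object C (ObjMap G Z)" if Z: "zero_object D Z" for Z
  proof (rule C.zero_objectI)
    have [simp]: "Z \<in> Obj D" using Z by (simp add: zero_object_def)
    show GZ: "ObjMap G Z \<in> Obj C" by simp
    have "\<epsilon> Z \<cdot>\<^bsub>D\<^esub> ArrMap F x = Zero D (ObjMap F (ObjMap G Z)) Z"
      if "x \<in> Hom C (ObjMap G Z) (ObjMap G Z)" for x
      using that D.zero_object_hom(1)[OF Z, of "\<epsilon> Z \<cdot>\<^bsub>D\<^esub> ArrMap F x"] by (simp add: Hom_def)
    note eq = this
    have homs: "Ident C (ObjMap G Z) \<in> Hom C (ObjMap G Z) (ObjMap G Z)"
      "Zero C (ObjMap G Z) (ObjMap G Z) \<in> Hom C (ObjMap G Z) (ObjMap G Z)"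
      by (simp_all add: Hom_def)
    show "Ident C (ObjMap G Z) = Zero C (ObjMap G Z) (ObjMap G Z)"
      by (rule transpose_inject[OF adj _ homs]) (simp_all only: eq[OF homs(1)] eq[OF homs(2)] \<open>Z \<in> Obj D\<close>)
  qed
  then show "zero_object D Z \<Longrightarrow> zero_object C (ObjMap G Z)" .
  obtain Z where Z: "zero_object D Z" using D.ex_zero_object by auto
  then have [simp]: "Z \<in> Obj D" by (simp add: zero_object_def)
  assume [simp]: "A \<in> Obj D" "B \<in> Obj D"
  have "ArrMap G (Zero D A B) = ArrMap G (Zero D Z B \<cdot>\<^bsub>D\<^esub> Zero D A Z)" by (subst D.zero_comp) simp_all
  also have "\<dots> = ArrMap G (Zero D Z B) \<cdot>\<^bsub>C\<^esub> ArrMap G (Zero D A Z)" by (subst functorD(6)[OF G]) simp_all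
  also have "\<dots> = Zero C (ObjMap G A) (ObjMap G B)"
    using C.zero_object_hom[OF zero[OF Z]] C.zero_object_hom(1)[OF zero[OF Z], of "ArrMap G (Zero D A Z)"] by simp
  finally show "ArrMap G (Zero D A B) = Zero C (ObjMap G A) (ObjMap G B)" .
qed

text \<open>A right adjoint sends the two projections of a biproduct to a jointly monic pair, so it
  preserves the decomposition of the identity, and the sum of two arrows factors through it.\<close>

lemma right_adjoint_add:
  assumes C: "preadditive_category C" and D: "additive_category D"
    and adj: "adjunction C D F G \<eta> \<epsilon>"
    and f: "f \<in> Arr D" and g: "g \<in> Arr D" "Dom D f = Dom D g" "Cod D f = Cod D g"
  shows "ArrMap G (f \<oplus>\<^bsub>D\<^esub> g) = ArrMap G f \<oplus>\<^bsub>C\<^esub> ArrMap G g"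
proof -
  interpret C: preadditive_category C by (rule C)
  interpret D: additive_category D by (rule D)
  note F = adjunctionD(1)[OF adj] and G = adjunctionD(2)[OF adj]
  note FG [simp] = functorD[OF F] functorD[OF G] adjunction_simps(1-3,5-7)[OF adj]
  define Y where "Y = Cod D g"
  have Y [simp]: "Y \<in> Obj D" using g D.cod_obj by (simp add: Y_def)
  note [simp] = f g Y_def[symmetric]
  obtain P i j p q where P [simp]: "P \<in> Obj D" and i: "i \<in> Hom D Y P" and j: "j \<in> Hom D Y P"
    and p: "p \<in> Hom D P Y" and q: "q \<in> Hom D P Y"
    and eqs: "p \<cdot>\<^bsub>D\<^esub> i = Ident D Y" "q \<cdot>\<^bsub>D\<^esub> j = Ident D Y" "p \<cdot>\<^bsub>D\<^esub> j = Zero D Y Y" "q \<cdot>\<^bsub>D\<^esub> i = Zero D Y Y"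
    and id: "(i \<cdot>\<^bsub>D\<^esub> p) \<oplus>\<^bsub>D\<^esub> (j \<cdot>\<^bsub>D\<^esub> q) = Ident D P"
    using D.ex_biproduct[OF Y Y] by blast
  note [simp] = HomD[OF i] HomD[OF j] HomD[OF p] HomD[OF q]
  have joint: "a = b"
    if a: "a \<in> Hom C X (ObjMap G P)" and b: "b \<in> Hom C X (ObjMap G P)"
      and ab: "ArrMap G p \<cdot>\<^bsub>C\<^esub> a = ArrMap G p \<cdot>\<^bsub>C\<^esub> b" "ArrMap G q \<cdot>\<^bsub>C\<^esub> a = ArrMap G q \<cdot>\<^bsub>C\<^esub> b" for a b X
  proof (rule transpose_inject[OF adj P a b])
    note [simp] = HomD[OF a] HomD[OF b]
    \<comment> \<open>Transposition turns composition with \<open>G r\<close> into composition with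
      \<open>r\<close>, so the hypotheses on \<open>a\<close> and \<open>b\<close> become equations
      in \<open>D\<close>, where an arrow into \<open>P\<close> is determined by its two
      components.\<close>
    have tr: "r \<cdot>\<^bsub>D\<^esub> (\<epsilon> P \<cdot>\<^bsub>D\<^esub> ArrMap F x) = \<epsilon> Y \<cdot>\<^bsub>D\<^esub> ArrMap F (ArrMap G r \<cdot>\<^bsub>C\<^esub> x)"
      if "r \<in> Arr D" "Dom D r = P" "Cod D r = Y" "x \<in> Arr C" "Cod C x = ObjMap G P" for r x
      using that adjunction_simps(8)[OF adj, of r]
        D.comp_assoc_arr[of "ArrMap F x" "\<epsilon> P" r]
        D.comp_assoc_arr[of "ArrMap F x" "ArrMap F (ArrMap G r)" "\<epsilon> Y"] by simp
    have dec: "x = i \<cdot>\<^bsub>D\<^esub> (p \<cdot>\<^bsub>D\<^esub> x) \<oplus>\<^bsub>D\<^esub> j \<cdot>\<^bsub>D\<^esub> (q \<cdot>\<^bsub>D\<^esub> x)" if "x \<in> Arr D" "Cod D x = P" for x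
    proof -
      have "x = (i \<cdot>\<^bsub>D\<^esub> p \<oplus>\<^bsub>D\<^esub> j \<cdot>\<^bsub>D\<^esub> q) \<cdot>\<^bsub>D\<^esub> x" using that by (simp only: id D.comp_ident)
      then show ?thesis using that by (simp add: D.comp_assoc_arr)
    qed
    show "\<epsilon> P \<cdot>\<^bsub>D\<^esub> ArrMap F a = \<epsilon> P \<cdot>\<^bsub>D\<^esub> ArrMap F b"
      by (subst dec[of "\<epsilon> P \<cdot>\<^bsub>D\<^esub> ArrMap F a"], simp, simp,
          subst dec[of "\<epsilon> P \<cdot>\<^bsub>D\<^esub> ArrMap F b"], simp, simp)
        (simp only: tr ab \<open>p \<in> Arr D\<close> HomD[OF p] HomD[OF q] HomD[OF a] HomD[OF b])
  qed
  let ?s = "ArrMap G i \<cdot>\<^bsub>C\<^esub> ArrMap G p \<oplus>\<^bsub>C\<^esub> ArrMap G j \<cdot>\<^bsub>C\<^esub> ArrMap G q"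
  have Geqs: "ArrMap G p \<cdot>\<^bsub>C\<^esub> ArrMap G i = Ident C (ObjMap G Y)"
    "ArrMap G q \<cdot>\<^bsub>C\<^esub> ArrMap G j = Ident C (ObjMap G Y)"
    "ArrMap G p \<cdot>\<^bsub>C\<^esub> ArrMap G j = Zero C (ObjMap G Y) (ObjMap G Y)"
    "ArrMap G q \<cdot>\<^bsub>C\<^esub> ArrMap G i = Zero C (ObjMap G Y) (ObjMap G Y)"
    using eqs[THEN arg_cong, of "ArrMap G"] right_adjoint_zero(2)[OF C D adj] by simp_all
  note re = Geqs[THEN C.comp_reassoc]
  have id': "?s = Ident C (ObjMap G P)"
    by (rule joint[of _ "ObjMap G P"]) (simp_all add: Hom_def re)
  \<comment> \<open>\<open>m\<close> is the pairing of \<open>f\<close> and \<open>g\<close> into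
    the biproduct and \<open>c\<close> the codiagonal, so their composite is the sum. Inserting the
    decomposed identity of \<open>G P\<close> between the images of \<open>c\<close> and
    \<open>m\<close> leaves the images of \<open>f\<close> and \<open>g\<close>.\<close>
  define m where "m = i \<cdot>\<^bsub>D\<^esub> f \<oplus>\<^bsub>D\<^esub> j \<cdot>\<^bsub>D\<^esub> g"
  define c where "c = p \<oplus>\<^bsub>D\<^esub> q"
  have [simp]: "m \<in> Arr D" "Dom D m = Dom D g" "Cod D m = P" "c \<in> Arr D" "Dom D c = P" "Cod D c = Y"
    by (simp_all add: m_def c_def)
  have [simp]: "Dom D g \<in> Obj D" by (simp add: D.dom_obj)
  note re' = eqs[THEN D.comp_reassoc]
  have pm: "p \<cdot>\<^bsub>D\<^esub> m = f" "q \<cdot>\<^bsub>D\<^esub> m = g" by (simp_all add: m_def re')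
  have ci: "c \<cdot>\<^bsub>D\<^esub> i = Ident D Y" "c \<cdot>\<^bsub>D\<^esub> j = Ident D Y" by (simp_all add: c_def eqs)
  have Gpm: "ArrMap G p \<cdot>\<^bsub>C\<^esub> ArrMap G m = ArrMap G f" "ArrMap G q \<cdot>\<^bsub>C\<^esub> ArrMap G m = ArrMap G g"
    "ArrMap G c \<cdot>\<^bsub>C\<^esub> ArrMap G i = Ident C (ObjMap G Y)" "ArrMap G c \<cdot>\<^bsub>C\<^esub> ArrMap G j = Ident C (ObjMap G Y)"
    using pm[THEN arg_cong, of "ArrMap G"] ci[THEN arg_cong, of "ArrMap G"] by simp_all
  have "f \<oplus>\<^bsub>D\<^esub> g = c \<cdot>\<^bsub>D\<^esub> m" by (simp add: c_def pm)
  then have "ArrMap G (f \<oplus>\<^bsub>D\<^esub> g) = ArrMap G c \<cdot>\<^bsub>C\<^esub> (?s \<cdot>\<^bsub>C\<^esub> ArrMap G m)"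
    unfolding id' by simp
  also have "\<dots> = ArrMap G f \<oplus>\<^bsub>C\<^esub> ArrMap G g"
    by (simp add: C.comp_assoc_arr Gpm Gpm(3,4)[THEN C.comp_reassoc])
  finally show ?thesis .
qed

text \<open>The rotation axiom changes signs, so carrying it back along \<open>G\<close> requires
  this.\<close>

lemma right_adjoint_neg:
  assumes C: "preadditive_category C" and D: "additive_category D"
    and adj: "adjunction C D F G \<eta> \<epsilon>" and f: "f \<in> Arr D"
  shows "ArrMap G (Neg D f) = Neg C (ArrMap G f)"
proof -
  interpret C: preadditive_category C by (rule C)
  interpret D: additive_category D by (rule D)
  note [simp] = functorD[OF adjunctionD(2)[OF adj]] f
  have [simp]: "Dom D f \<in> Obj D" "Cod D f \<in> Obj D" by (simp_all add: D.dom_obj D.cod_obj)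
  have "ArrMap G f \<oplus>\<^bsub>C\<^esub> ArrMap G (Neg D f) = ArrMap G (f \<oplus>\<^bsub>D\<^esub> Neg D f)"
    by (rule right_adjoint_add[OF C D adj, symmetric]) simp_all
  then show ?thesis
    by (intro C.neg_unique) (simp_all add: right_adjoint_zero(2)[OF C D adj])
qed

section \<open>Separable right adjoints with exact monad\<close>

lemma triangle_map_functor:
  assumes F: "is_functor C D F" and susp: "functor_commutes_susp C D F"
    and t: "(u, v, w) \<in> triangles C" and t': "(u', v', w') \<in> triangles C"
    and m: "triangle_map C (u, v, w) (u', v', w') f g h"
    and S: "is_functor C C (Susp C)"
  shows "triangle_map D (map_triangle F (u, v, w)) (map_triangle F (u', v', w'))
    (ArrMap F f) (ArrMap F g) (ArrMap F h)"
proof -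
  note [simp] = functorD[OF F] functorD[OF S] triangleD[OF t] triangleD[OF t']
  have m': "f \<in> Arr C" "Dom C f = Dom C u" "Cod C f = Dom C u'"
    "g \<in> Arr C" "Dom C g = Dom C v" "Cod C g = Dom C v'"
    "h \<in> Arr C" "Dom C h = Dom C w" "Cod C h = Dom C w'"
    "g \<cdot>\<^bsub>C\<^esub> u = u' \<cdot>\<^bsub>C\<^esub> f" "h \<cdot>\<^bsub>C\<^esub> v = v' \<cdot>\<^bsub>C\<^esub> g"
    "ArrMap (Susp C) f \<cdot>\<^bsub>C\<^esub> w = w' \<cdot>\<^bsub>C\<^esub> h"
    using m by (simp_all add: Hom_def)
  have "ArrMap F (ArrMap (Susp C) x) = ArrMap (Susp D) (ArrMap F x)" if "x \<in> Arr C" for x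
    using susp that by (simp add: functor_commutes_susp_def functor_eq_def comp_functor_def)
  then show ?thesis
    using m'(1-9) m'(10-12)[THEN arg_cong, of "ArrMap F"] by (simp add: Hom_def)
qed

lemma functor_triangle:
  assumes F: "is_functor C D F" and susp: "functor_commutes_susp C D F"
    and t: "t \<in> triangles C"
  shows "map_triangle F t \<in> triangles D"
proof -
  obtain u v w where uvw: "t = (u, v, w)" by (cases t)
  note [simp] = functorD[OF F] triangleD[OF t[unfolded uvw]]
  interpret category C using F by (simp add: is_functor_def)
  have "ObjMap F (ObjMap (Susp C) (Dom C u)) = ObjMap (Susp D) (ObjMap F (Dom C u))"
    using susp dom_obj[of u] by (simp add: functor_commutes_susp_def functor_eq_def comp_functor_def)
  then show ?thesis by (simp add: uvw triangles_def)
qed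

lemma triangle_iso_functor:
  assumes F: "is_functor C D F" and susp: "functor_commutes_susp C D F"
    and S: "is_functor C C (Susp C)"
    and t: "t \<in> triangles C" and t': "t' \<in> triangles C" and iso: "triangle_iso C t t'"
  shows "triangle_iso D (map_triangle F t) (map_triangle F t')"
proof -
  obtain u v w u' v' w' where uvw: "t = (u, v, w)" "t' = (u', v', w')" by (cases t, cases t')
  obtain f g h where "triangle_map C t t' f g h" and iso: "is_iso C f" "is_iso C g" "is_iso C h"
    using iso by (auto simp: triangle_iso_def)
  then have "triangle_map D (map_triangle F t) (map_triangle F t') (ArrMap F f) (ArrMap F g) (ArrMap F h)"
    using triangle_map_functor[OF F susp _ _ _ S] t t' unfolding uvw by blast
  then show ?thesis
    unfolding triangle_iso_def using iso[THEN functor_iso[OF F]] by blast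
qed

text \<open>The case where \<open>G\<close> is separable, that is, where the associated idempotent is the identity.\<close>

locale separable_adjunction =
  C: pretriangulated_category C \<Delta> + E: suspended_category E
  for C :: "('co, 'cm, 'y) susp_cat_scheme" and \<Delta> :: "'cm triangle set"
    and E :: "('eo, 'em, 'z) susp_cat_scheme" +
  fixes F :: "('co, 'cm, 'eo, 'em) functor_data" and G :: "('eo, 'em, 'co, 'cm) functor_data"
    and \<eta> :: "'co \<Rightarrow> 'cm" and \<epsilon> :: "'eo \<Rightarrow> 'em" and P :: "'eo \<Rightarrow> 'eo \<Rightarrow> 'cm \<Rightarrow> 'em"
  assumes idempotents_split: "idempotent_complete E"
    and susp_adj: "susp_adjunction C E F G \<eta> \<epsilon>"
    and exact_GF: "exact_functor C \<Delta> C \<Delta> (G \<circ>\<^sub>F F)"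
    and semisep: "semiseparable_via E C G P"
    and P_G: "\<lbrakk>X \<in> Obj E; Y \<in> Obj E; f \<in> Hom E X Y\<rbrakk> \<Longrightarrow> P X Y (ArrMap G f) = f"
begin

definition distinguished :: "'em triangle set" where
  "distinguished = {t \<in> triangles E. map_triangle G t \<in> \<Delta>}"

lemma adj: "adjunction C E F G \<eta> \<epsilon>"
  and F_susp: "functor_commutes_susp C E F" and G_susp: "functor_commutes_susp E C G"
  using susp_adj by (simp_all add: susp_adjunction_def)

lemmas F_functor = adjunctionD(1)[OF adj] and G_functor = adjunctionD(2)[OF adj]

lemmas F_simps [simp] = functorD[OF F_functor]
lemmas G_simps [simp] = functorD[OF G_functor]
lemmas adj_simps [simp] = adjunction_simps(1-3,5-7)[OF adj]

lemma susp_commute [simp]: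
  "X \<in> Obj C \<Longrightarrow> ObjMap F (ObjMap (Susp C) X) = ObjMap (Susp E) (ObjMap F X)"
  "f \<in> Arr C \<Longrightarrow> ArrMap F (ArrMap (Susp C) f) = ArrMap (Susp E) (ArrMap F f)"
  "Y \<in> Obj E \<Longrightarrow> ObjMap G (ObjMap (Susp E) Y) = ObjMap (Susp C) (ObjMap G Y)"
  "g \<in> Arr E \<Longrightarrow> ArrMap G (ArrMap (Susp E) g) = ArrMap (Susp C) (ArrMap G g)"
  using F_susp G_susp by (simp_all add: functor_commutes_susp_def functor_eq_def comp_functor_def)

lemma P_arr [simp]:
  assumes "X \<in> Obj E" "Y \<in> Obj E" "k \<in> Arr C" "Dom C k = ObjMap G X" "Cod C k = ObjMap G Y"
  shows "P X Y k \<in> Arr E" "Dom E (P X Y k) = X" "Cod E (P X Y k) = Y"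
proof -
  have "P X Y k \<in> Hom E X Y"
    using semisep assms by (auto simp: semiseparable_via_def Hom_def)
  then show "P X Y k \<in> Arr E" "Dom E (P X Y k) = X" "Cod E (P X Y k) = Y"
    by (auto simp: Hom_def)
qed

lemma P_natural:
  assumes "f \<in> Arr E" "g \<in> Arr E" "k \<in> Arr C"
    and "Dom C k = ObjMap G (Cod E f)" "Cod C k = ObjMap G (Dom E g)"
  shows "P (Dom E f) (Cod E g) (ArrMap G g \<cdot>\<^bsub>C\<^esub> (k \<cdot>\<^bsub>C\<^esub> ArrMap G f))
    = g \<cdot>\<^bsub>E\<^esub> (P (Cod E f) (Dom E g) k \<cdot>\<^bsub>E\<^esub> f)"
proof -
  have nat: "\<forall>X \<in> Obj E. \<forall>Y \<in> Obj E. \<forall>X' \<in> Obj E. \<forall>Y' \<in> Obj E.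
        \<forall>f \<in> Hom E X' X. \<forall>g \<in> Hom E Y Y'. \<forall>k \<in> Hom C (ObjMap G X) (ObjMap G Y).
          P X' Y' (ArrMap G g \<cdot>\<^bsub>C\<^esub> (k \<cdot>\<^bsub>C\<^esub> ArrMap G f)) = g \<cdot>\<^bsub>E\<^esub> (P X Y k \<cdot>\<^bsub>E\<^esub> f)"
    using semisep unfolding semiseparable_via_def by blast
  show ?thesis
    by (rule nat[rule_format]) (simp_all add: assms E.dom_obj E.cod_obj HomI)
qed

lemma P_comp_right:
  assumes "f \<in> Arr E" "k \<in> Arr C" "Dom C k = ObjMap G (Cod E f)" "Cod C k = ObjMap G Y" "Y \<in> Obj E"
  shows "P (Dom E f) Y (k \<cdot>\<^bsub>C\<^esub> ArrMap G f) = P (Cod E f) Y k \<cdot>\<^bsub>E\<^esub> f"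
  using P_natural[of f "Ident E Y" k] assms by (simp add: E.dom_obj E.cod_obj)

lemma P_comp_left:
  assumes "g \<in> Arr E" "k \<in> Arr C" "Dom C k = ObjMap G X" "Cod C k = ObjMap G (Dom E g)" "X \<in> Obj E"
  shows "P X (Cod E g) (ArrMap G g \<cdot>\<^bsub>C\<^esub> k) = g \<cdot>\<^bsub>E\<^esub> P X (Dom E g) k"
  using P_natural[of "Ident E X" g k] assms by (simp add: E.dom_obj E.cod_obj)

lemma P_G_arr: "f \<in> Arr E \<Longrightarrow> P (Dom E f) (Cod E f) (ArrMap G f) = f"
  by (rule P_G) (simp_all add: E.dom_obj E.cod_obj Hom_def)

lemma G_faithful:
  assumes "f \<in> Arr E" "g \<in> Arr E" "Dom E f = Dom E g" "Cod E f = Cod E g" "ArrMap G f = ArrMap G g"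
  shows "f = g"
proof -
  have "f = P (Dom E f) (Cod E f) (ArrMap G f)" by (rule P_G_arr[symmetric]) (rule assms)
  also have "\<dots> = P (Dom E g) (Cod E g) (ArrMap G g)" by (simp only: assms(3-5))
  also have "\<dots> = g" by (rule P_G_arr) (rule assms)
  finally show ?thesis .
qed

lemma G_zero [simp]:
  "\<lbrakk>A \<in> Obj E; B \<in> Obj E\<rbrakk> \<Longrightarrow> ArrMap G (Zero E A B) = Zero C (ObjMap G A) (ObjMap G B)"
  by (rule right_adjoint_zero(2)[OF C.preadditive_category_axioms E.additive_category_axioms adj])

lemma G_neg [simp]: "f \<in> Arr E \<Longrightarrow> ArrMap G (Neg E f) = Neg C (ArrMap G f)"
  by (rule right_adjoint_neg[OF C.preadditive_category_axioms E.additive_category_axioms adj])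

section \<open>Triangles tested in \<open>C\<close>: images under \<open>F\<close> and completion of
  morphisms\<close>

lemma distinguishedD:
  assumes "(u, v, w) \<in> distinguished"
  shows "(u, v, w) \<in> triangles E" "(ArrMap G u, ArrMap G v, ArrMap G w) \<in> \<Delta>"
  using assms by (auto simp: distinguished_def)

text \<open>Being distinguished in \<open>E\<close> is tested after applying \<open>G\<close>, and
  the monad is exact.\<close>

lemma F_distinguished:
  assumes "t \<in> \<Delta>"
  shows "map_triangle F t \<in> distinguished"
proof -
  have "map_triangle G (map_triangle F t) = map_triangle (G \<circ>\<^sub>F F) t"
    by (cases t) (simp add: comp_functor_def)
  then show ?thesis
    using assms exact_GF C.distinguished_triangles functor_triangle[OF F_functor F_susp, of t]
    by (auto simp: distinguished_def exact_functor_def)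
qed

lemma completion:
  assumes t: "(u, v, w) \<in> distinguished" and t': "(u', v', w') \<in> distinguished"
    and f: "f \<in> Hom E (Dom E u) (Dom E u')" and g: "g \<in> Hom E (Cod E u) (Cod E u')"
    and sq: "g \<cdot>\<^bsub>E\<^esub> u = u' \<cdot>\<^bsub>E\<^esub> f"
  obtains h where "triangle_map E (u, v, w) (u', v', w') f g h"
proof -
  note [simp] = triangleD[OF distinguishedD(1)[OF t]] triangleD[OF distinguishedD(1)[OF t']]
    HomD[OF f] HomD[OF g]
  have [simp]: "Dom E w \<in> Obj E" "Dom E w' \<in> Obj E" "Dom E u' \<in> Obj E" by (simp_all add: E.dom_obj)
  obtain k where "triangle_map C (ArrMap G u, ArrMap G v, ArrMap G w)
      (ArrMap G u', ArrMap G v', ArrMap G w') (ArrMap G f) (ArrMap G g) k"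
    using C.ex_completion[OF distinguishedD(2)[OF t] distinguishedD(2)[OF t'], of "ArrMap G f" "ArrMap G g"]
      arg_cong[OF sq, of "ArrMap G"] by (auto simp: Hom_def)
  then have [simp]: "k \<in> Arr C" "Dom C k = ObjMap G (Dom E w)" "Cod C k = ObjMap G (Dom E w')"
    and k: "k \<cdot>\<^bsub>C\<^esub> ArrMap G v = ArrMap G v' \<cdot>\<^bsub>C\<^esub> ArrMap G g"
      "ArrMap (Susp C) (ArrMap G f) \<cdot>\<^bsub>C\<^esub> ArrMap G w = ArrMap G w' \<cdot>\<^bsub>C\<^esub> k"
    by (simp_all add: Hom_def)
  \<comment> \<open>\<open>k\<close> need not be the image of an arrow. Naturality moves
    \<open>v\<close> and \<open>w'\<close> inside \<open>P\<close>, where the squares for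
    \<open>k\<close> turn the argument into the image of an arrow of \<open>E\<close>, and on images
    \<open>P\<close> inverts \<open>G\<close>.\<close>
  let ?h = "P (Dom E w) (Dom E w') k"
  have "?h \<cdot>\<^bsub>E\<^esub> v = P (Dom E v) (Dom E w') (k \<cdot>\<^bsub>C\<^esub> ArrMap G v)"
    using P_comp_right[of v k "Dom E w'"] by simp
  also have "\<dots> = v' \<cdot>\<^bsub>E\<^esub> g" using P_G_arr[of "v' \<cdot>\<^bsub>E\<^esub> g"] by (simp add: k)
  finally have 1: "?h \<cdot>\<^bsub>E\<^esub> v = v' \<cdot>\<^bsub>E\<^esub> g" .
  have "w' \<cdot>\<^bsub>E\<^esub> ?h = P (Dom E w) (Cod E w') (ArrMap G w' \<cdot>\<^bsub>C\<^esub> k)"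
    using P_comp_left[of w' k "Dom E w"] by simp
  also have "\<dots> = ArrMap (Susp E) f \<cdot>\<^bsub>E\<^esub> w"
    using P_G_arr[of "ArrMap (Susp E) f \<cdot>\<^bsub>E\<^esub> w"] by (simp flip: k)
  finally have "ArrMap (Susp E) f \<cdot>\<^bsub>E\<^esub> w = w' \<cdot>\<^bsub>E\<^esub> ?h" ..
  with 1 have "triangle_map E (u, v, w) (u', v', w') f g ?h" by (simp add: Hom_def sq)
  then show thesis by (rule that)
qed

section \<open>The section of the counit and the construction of cones\<close>

definition \<zeta> :: "'eo \<Rightarrow> 'em" where
  "\<zeta> X = P X (ObjMap F (ObjMap G X)) (\<eta> (ObjMap G X))"

lemma \<zeta>_arr [simp]:
  assumes "X \<in> Obj E"
  shows "\<zeta> X \<in> Arr E" "Dom E (\<zeta> X) = X" "Cod E (\<zeta> X) = ObjMap F (ObjMap G X)"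
  using assms by (simp_all add: \<zeta>_def)

text \<open>Naturality moves the counit inside \<open>P\<close>; a triangle identity leaves
  \<open>P\<close> of an identity arrow.\<close>

lemma counit_section: "X \<in> Obj E \<Longrightarrow> \<epsilon> X \<cdot>\<^bsub>E\<^esub> \<zeta> X = Ident E X"
  using P_comp_left[of "\<epsilon> X" "\<eta> (ObjMap G X)" X] P_G_arr[of "Ident E X"]
  by (simp add: \<zeta>_def adjunctionD(6)[OF adj])

text \<open>Makes \<open>u\<close> a retract of \<open>F (G u)\<close> as an arrow, not only object
  by object. It combines naturality of \<open>P\<close> in both variables with that of
  \<open>\<eta>\<close>.\<close>

lemma \<zeta>_natural:
  assumes [simp]: "u \<in> Arr E"
  shows "ArrMap F (ArrMap G u) \<cdot>\<^bsub>E\<^esub> \<zeta> (Dom E u) = \<zeta> (Cod E u) \<cdot>\<^bsub>E\<^esub> u"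
proof -
  have [simp]: "Dom E u \<in> Obj E" "Cod E u \<in> Obj E" by (simp_all add: E.dom_obj E.cod_obj)
  have "ArrMap F (ArrMap G u) \<cdot>\<^bsub>E\<^esub> \<zeta> (Dom E u)
      = P (Dom E u) (ObjMap F (ObjMap G (Cod E u))) (ArrMap G (ArrMap F (ArrMap G u)) \<cdot>\<^bsub>C\<^esub> \<eta> (ObjMap G (Dom E u)))"
    using P_comp_left[of "ArrMap F (ArrMap G u)" "\<eta> (ObjMap G (Dom E u))" "Dom E u"] by (simp add: \<zeta>_def)
  also have "\<dots> = P (Dom E u) (ObjMap F (ObjMap G (Cod E u))) (\<eta> (ObjMap G (Cod E u)) \<cdot>\<^bsub>C\<^esub> ArrMap G u)"
    using adjunction_simps(4)[OF adj, of "ArrMap G u"] by simp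
  also have "\<dots> = \<zeta> (Cod E u) \<cdot>\<^bsub>E\<^esub> u"
    using P_comp_right[of u "\<eta> (ObjMap G (Cod E u))" "ObjMap F (ObjMap G (Cod E u))"] by (simp add: \<zeta>_def)
  finally show ?thesis .
qed

lemma retract_of_distinguished:
  assumes t: "(u, v, w) \<in> triangles E" and T: "(U, V, W) \<in> distinguished"
    and inc: "triangle_map E (u, v, w) (U, V, W) i j k"
    and proj: "triangle_map E (U, V, W) (u, v, w) p q r"
    and ret: "p \<cdot>\<^bsub>E\<^esub> i = Ident E (Dom E u)" "q \<cdot>\<^bsub>E\<^esub> j = Ident E (Dom E v)" "r \<cdot>\<^bsub>E\<^esub> k = Ident E (Dom E w)"
  shows "(u, v, w) \<in> distinguished"
proof -
  note [simp] = triangleD[OF t] triangleD[OF distinguishedD(1)[OF T]]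
  have [simp]: "i \<in> Arr E" "j \<in> Arr E" "k \<in> Arr E" "p \<in> Arr E" "q \<in> Arr E" "r \<in> Arr E"
    "Cod E i = Dom E p" "Cod E j = Dom E q" "Cod E k = Dom E r"
    using inc proj by (simp_all add: Hom_def)
  have tG: "(ArrMap G u, ArrMap G v, ArrMap G w) \<in> triangles C"
    using functor_triangle[OF G_functor G_susp t] by simp
  have maps: "triangle_map C (ArrMap G u, ArrMap G v, ArrMap G w) (ArrMap G U, ArrMap G V, ArrMap G W)
      (ArrMap G i) (ArrMap G j) (ArrMap G k)"
    "triangle_map C (ArrMap G U, ArrMap G V, ArrMap G W) (ArrMap G u, ArrMap G v, ArrMap G w)
      (ArrMap G p) (ArrMap G q) (ArrMap G r)"
    using triangle_map_functor[OF G_functor G_susp t distinguishedD(1)[OF T] inc E.susp_functor]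
      triangle_map_functor[OF G_functor G_susp distinguishedD(1)[OF T] t proj E.susp_functor]
    by (simp_all only: map_triangle.simps)
  have "(ArrMap G u, ArrMap G v, ArrMap G w) \<in> \<Delta>"
    by (rule C.retract_distinguished[OF tG distinguishedD(2)[OF T] maps])
      (use ret[THEN arg_cong, of "ArrMap G"] in \<open>simp_all add: E.dom_obj\<close>)
  then show ?thesis using t by (simp add: distinguished_def)
qed

lemma ex_cone:
  assumes u [simp]: "u \<in> Arr E"
  obtains v w where "(u, v, w) \<in> distinguished"
proof -
  define X Y where "X = Dom E u" and "Y = Cod E u"
  have XY [simp]: "X \<in> Obj E" "Y \<in> Obj E" "Dom E u = X" "Cod E u = Y"
    by (simp_all add: X_def Y_def E.dom_obj E.cod_obj)
  let ?U = "ArrMap F (ArrMap G u)"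
  obtain V0 W0 where T0: "(ArrMap G u, V0, W0) \<in> \<Delta>" using C.ex_distinguished[of "ArrMap G u"] by auto
  define V W where "V = ArrMap F V0" and "W = ArrMap F W0"
  have T: "(?U, V, W) \<in> distinguished" using F_distinguished[OF T0] by (simp add: V_def W_def)
  have U: "Dom E ?U = ObjMap F (ObjMap G X)" "Cod E ?U = ObjMap F (ObjMap G Y)" "?U \<in> Arr E" by simp_all
  note VW = triangleD[OF distinguishedD(1)[OF T]]
  have V [simp]: "V \<in> Arr E" "Dom E V = ObjMap F (ObjMap G Y)" "Cod E V = Dom E W"
    and W [simp]: "W \<in> Arr E" "Cod E W = ObjMap (Susp E) (ObjMap F (ObjMap G X))"
    using VW U by simp_all
  define Z where "Z = Dom E W"
  have Z [simp]: "Z \<in> Obj E" "Dom E W = Z" by (simp_all add: Z_def E.dom_obj)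
  define p where "p = \<zeta> X \<cdot>\<^bsub>E\<^esub> \<epsilon> X"
  define q where "q = \<zeta> Y \<cdot>\<^bsub>E\<^esub> \<epsilon> Y"
  have p [simp]: "p \<in> Arr E" "Dom E p = ObjMap F (ObjMap G X)" "Cod E p = ObjMap F (ObjMap G X)"
    and q [simp]: "q \<in> Arr E" "Dom E q = ObjMap F (ObjMap G Y)" "Cod E q = ObjMap F (ObjMap G Y)"
    by (simp_all add: p_def q_def)
  note sec = counit_section[OF XY(1)] counit_section[OF XY(2)]
  note sec' = sec[THEN E.comp_reassoc]
  have pp: "p \<cdot>\<^bsub>E\<^esub> p = p" and qq: "q \<cdot>\<^bsub>E\<^esub> q = q"
    by (simp_all add: p_def q_def E.comp_assoc_arr sec')
  have Uz: "?U \<cdot>\<^bsub>E\<^esub> \<zeta> X = \<zeta> Y \<cdot>\<^bsub>E\<^esub> u" using \<zeta>_natural[OF u] by simp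
  have eU: "\<epsilon> Y \<cdot>\<^bsub>E\<^esub> ?U = u \<cdot>\<^bsub>E\<^esub> \<epsilon> X" using adjunction_simps(8)[OF adj u] by simp
  have "q \<cdot>\<^bsub>E\<^esub> ?U = ?U \<cdot>\<^bsub>E\<^esub> p"
    by (simp add: p_def q_def E.comp_assoc_arr eU Uz[THEN E.comp_reassoc])
  then obtain h where "triangle_map E (?U, V, W) (?U, V, W) p q h"
    using completion[OF T T, of p q] by (auto simp: Hom_def)
  then have h [simp]: "h \<in> Arr E" "Dom E h = Z" "Cod E h = Z"
    and hV: "h \<cdot>\<^bsub>E\<^esub> V = V \<cdot>\<^bsub>E\<^esub> q" and Wh: "ArrMap (Susp E) p \<cdot>\<^bsub>E\<^esub> W = W \<cdot>\<^bsub>E\<^esub> h"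
    by (simp_all add: Hom_def)
  have Spp: "ArrMap (Susp E) p \<cdot>\<^bsub>E\<^esub> ArrMap (Susp E) p = ArrMap (Susp E) p"
    using arg_cong[OF pp, of "ArrMap (Susp E)"] by simp
  define n where "n = h \<cdot>\<^bsub>E\<^esub> h \<oplus>\<^bsub>E\<^esub> Neg E h"
  have n [simp]: "n \<in> Arr E" "Dom E n = Z" "Cod E n = Z" by (simp_all add: n_def)
  have nV: "n \<cdot>\<^bsub>E\<^esub> V = Zero E (Dom E V) Z"
    using hV[THEN E.comp_reassoc, of q] by (simp add: n_def E.comp_assoc_arr hV qq)
  have Wn: "W \<cdot>\<^bsub>E\<^esub> n = Zero E Z (Cod E W)"
    using E.comp_reassoc[OF Wh[symmetric], of h] E.comp_reassoc[OF Spp, of W]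
    by (simp add: n_def E.comp_assoc_arr flip: Wh)
  \<comment> \<open>The triangle axioms are not yet available in \<open>E\<close>, so
    \<open>square_zero\<close> is applied to the image under \<open>G\<close> and the equation is
    pulled back by faithfulness.\<close>
  have nn: "n \<cdot>\<^bsub>E\<^esub> n = Zero E Z Z"
  proof (rule G_faithful)
    have "ArrMap G n \<cdot>\<^bsub>C\<^esub> ArrMap G n = Zero C (Dom C (ArrMap G W)) (Dom C (ArrMap G W))"
      by (rule C.square_zero[OF distinguishedD(2)[OF T]])
        (use nV[THEN arg_cong, of "ArrMap G"] Wn[THEN arg_cong, of "ArrMap G"] in \<open>simp_all\<close>)
    then show "ArrMap G (n \<cdot>\<^bsub>E\<^esub> n) = ArrMap G (Zero E Z Z)" by simp
  qed simp_all
  have hZ: "h \<in> Hom E Z Z" by (simp add: Hom_def)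
  obtain k where k: "k \<in> Hom E Z Z" "k \<cdot>\<^bsub>E\<^esub> k = k"
    and k_left: "\<And>Y v q. \<lbrakk>v \<in> Hom E Y Z; q \<in> Hom E Y Y; q \<cdot>\<^bsub>E\<^esub> q = q; h \<cdot>\<^bsub>E\<^esub> v = v \<cdot>\<^bsub>E\<^esub> q\<rbrakk>
      \<Longrightarrow> k \<cdot>\<^bsub>E\<^esub> v = v \<cdot>\<^bsub>E\<^esub> q"
    and k_right: "\<And>X w p. \<lbrakk>w \<in> Hom E Z X; p \<in> Hom E X X; p \<cdot>\<^bsub>E\<^esub> p = p; w \<cdot>\<^bsub>E\<^esub> h = p \<cdot>\<^bsub>E\<^esub> w\<rbrakk>
      \<Longrightarrow> w \<cdot>\<^bsub>E\<^esub> k = p \<cdot>\<^bsub>E\<^esub> w"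
    by (fact E.idempotent_lift[OF hZ Z(1) nn[unfolded n_def]])
  \<comment> \<open>\<open>k\<close> satisfies the same two squares as \<open>h\<close>, so
    \<open>p\<close>, \<open>q\<close>, \<open>k\<close> form an idempotent endomorphism of the
    triangle.\<close>
  have kV: "k \<cdot>\<^bsub>E\<^esub> V = V \<cdot>\<^bsub>E\<^esub> q"
    by (rule k_left[OF _ _ qq hV]) (simp_all add: Hom_def)
  have Wk: "W \<cdot>\<^bsub>E\<^esub> k = ArrMap (Susp E) p \<cdot>\<^bsub>E\<^esub> W"
    by (rule k_right[OF _ _ Spp Wh[symmetric]]) (simp_all add: Hom_def)
  obtain Q r s where [simp]: "Q \<in> Obj E" and r: "r \<in> Hom E Z Q" and s: "s \<in> Hom E Q Z"
    and sr: "s \<cdot>\<^bsub>E\<^esub> r = k" and rs: "r \<cdot>\<^bsub>E\<^esub> s = Ident E Q"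
    using idempotents_split k unfolding idempotent_complete_def by (metis Z(1))
  note [simp] = HomD[OF k(1)] HomD[OF r] HomD[OF s]
  \<comment> \<open>Both formulas are forced: if \<open>\<zeta> X\<close>, \<open>\<zeta> Y\<close>,
    \<open>s\<close> is to be a morphism of triangles, composing its squares with \<open>r\<close>
    and with the suspension of \<open>\<epsilon> X\<close> yields exactly these arrows.\<close>
  define v where "v = r \<cdot>\<^bsub>E\<^esub> (V \<cdot>\<^bsub>E\<^esub> \<zeta> Y)"
  define w where "w = ArrMap (Susp E) (\<epsilon> X) \<cdot>\<^bsub>E\<^esub> (W \<cdot>\<^bsub>E\<^esub> s)"
  have vw [simp]: "v \<in> Arr E" "Dom E v = Y" "Cod E v = Q" "w \<in> Arr E" "Dom E w = Q" "Cod E w = ObjMap (Susp E) X"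
    by (simp_all add: v_def w_def)
  have t: "(u, v, w) \<in> triangles E" by (simp add: triangles_def)
  have Ssec: "ArrMap (Susp E) (\<epsilon> X) \<cdot>\<^bsub>E\<^esub> ArrMap (Susp E) (\<zeta> X) = Ident E (ObjMap (Susp E) X)"
    using arg_cong[OF sec(1), of "ArrMap (Susp E)"] by simp
  have Sp: "ArrMap (Susp E) (\<zeta> X) \<cdot>\<^bsub>E\<^esub> ArrMap (Susp E) (\<epsilon> X) = ArrMap (Susp E) p"
    by (simp add: p_def)
  \<comment> \<open>The halves of a splitting absorb their idempotent: \<open>s\<close> and
    \<open>r\<close> absorb \<open>k\<close>, and \<open>\<zeta> Y\<close> absorbs \<open>q\<close>.
    With \<open>kV\<close> and \<open>Wk\<close> this yields the squares of the inclusion and of the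
    projection.\<close>
  have ks: "k \<cdot>\<^bsub>E\<^esub> s = s" and rk: "r \<cdot>\<^bsub>E\<^esub> k = r"
    by (simp_all add: E.comp_assoc_arr rs rs[THEN E.comp_reassoc] flip: sr)
  have qz: "q \<cdot>\<^bsub>E\<^esub> \<zeta> Y = \<zeta> Y" by (simp add: q_def E.comp_assoc_arr sec)
  have sv: "s \<cdot>\<^bsub>E\<^esub> v = V \<cdot>\<^bsub>E\<^esub> \<zeta> Y"
    by (simp add: v_def sr[THEN E.comp_reassoc] kV[THEN E.comp_reassoc] E.comp_assoc_arr qz)
  have Wk': "ArrMap (Susp E) p \<cdot>\<^bsub>E\<^esub> (W \<cdot>\<^bsub>E\<^esub> x) = W \<cdot>\<^bsub>E\<^esub> (k \<cdot>\<^bsub>E\<^esub> x)"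
    if "x \<in> Arr E" "Cod E x = Z" for x
    using that by (simp add: Wk[symmetric, THEN E.comp_reassoc] E.comp_assoc_arr)
  have zw: "ArrMap (Susp E) (\<zeta> X) \<cdot>\<^bsub>E\<^esub> w = W \<cdot>\<^bsub>E\<^esub> s"
    using Wk'[of s] by (simp add: w_def Sp[THEN E.comp_reassoc] ks del: E.susp_simps(6))
  have ve: "r \<cdot>\<^bsub>E\<^esub> V = v \<cdot>\<^bsub>E\<^esub> \<epsilon> Y"
  proof -
    have "v \<cdot>\<^bsub>E\<^esub> \<epsilon> Y = r \<cdot>\<^bsub>E\<^esub> (V \<cdot>\<^bsub>E\<^esub> q)" by (simp add: v_def q_def E.comp_assoc_arr)
    also have "\<dots> = r \<cdot>\<^bsub>E\<^esub> V" by (simp add: rk[THEN E.comp_reassoc] flip: kV)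
    finally show ?thesis ..
  qed
  have we: "ArrMap (Susp E) (\<epsilon> X) \<cdot>\<^bsub>E\<^esub> W = w \<cdot>\<^bsub>E\<^esub> r"
  proof -
    have "w \<cdot>\<^bsub>E\<^esub> r = ArrMap (Susp E) (\<epsilon> X) \<cdot>\<^bsub>E\<^esub> (W \<cdot>\<^bsub>E\<^esub> k)"
      by (simp add: w_def E.comp_assoc_arr sr)
    also have "\<dots> = ArrMap (Susp E) (\<epsilon> X) \<cdot>\<^bsub>E\<^esub> (ArrMap (Susp E) (\<zeta> X) \<cdot>\<^bsub>E\<^esub> (ArrMap (Susp E) (\<epsilon> X) \<cdot>\<^bsub>E\<^esub> W))"
      by (simp add: Wk Sp[symmetric] E.comp_assoc_arr)
    also have "\<dots> = ArrMap (Susp E) (\<epsilon> X) \<cdot>\<^bsub>E\<^esub> W"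
      by (simp add: Ssec[THEN E.comp_reassoc])
    finally show ?thesis ..
  qed
  have inc: "triangle_map E (u, v, w) (?U, V, W) (\<zeta> X) (\<zeta> Y) s"
    by (simp add: Hom_def Uz sv zw)
  have proj: "triangle_map E (?U, V, W) (u, v, w) (\<epsilon> X) (\<epsilon> Y) r"
    by (simp add: Hom_def eU ve we)
  have "(u, v, w) \<in> distinguished"
    by (rule retract_of_distinguished[OF t T inc proj]) (simp_all add: sec rs)
  then show thesis by (rule that)
qed

text \<open>Closure under isomorphism, the trivial triangles and rotation pass from \<open>C\<close>
  to \<open>E\<close> because \<open>G\<close> preserves isomorphisms, zero objects and
  signs.\<close>

lemma pretriangulated: "pretriangulated_category E distinguished"
proof unfold_locales
  show "distinguished \<subseteq> triangles E" by (auto simp: distinguished_def)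
next
  fix t t' assume t: "t \<in> distinguished" and t': "t' \<in> triangles E" and iso: "triangle_iso E t t'"
  then have "map_triangle G t' \<in> \<Delta>"
    using triangle_iso_functor[OF G_functor G_susp E.susp_functor _ t' iso]
      C.iso_closed[of "map_triangle G t" "map_triangle G t'"] functor_triangle[OF G_functor G_susp t']
    by (simp add: distinguished_def)
  then show "t' \<in> distinguished" using t' by (simp add: distinguished_def)
next
  fix X Z assume [simp]: "X \<in> Obj E" and Z: "zero_object E Z"
  have [simp]: "Z \<in> Obj E" using Z by (simp add: zero_object_def)
  show "(Ident E X, Zero E X Z, Zero E Z (ObjMap (Susp E) X)) \<in> distinguished"
    using C.ident_distinguished[of "ObjMap G X" "ObjMap G Z"]
      right_adjoint_zero(1)[OF C.preadditive_category_axioms E.additive_category_axioms adj Z]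
    by (simp add: distinguished_def triangles_def)
next
  fix u assume "u \<in> Arr E"
  then show "\<exists>v w. (u, v, w) \<in> distinguished" using ex_cone by blast
next
  fix u v w assume t: "(u, v, w) \<in> triangles E"
  have "(ArrMap G u, ArrMap G v, ArrMap G w) \<in> triangles C"
    using functor_triangle[OF G_functor G_susp t] by simp
  from C.rotate[OF this] show "(u, v, w) \<in> distinguished \<longleftrightarrow>
      (Neg E v, Neg E w, Neg E (ArrMap (Susp E) u)) \<in> distinguished"
    using triangleD[OF t] by (simp add: distinguished_def triangles_def)
next
  fix u v w u' v' w' f g
  assume "(u, v, w) \<in> distinguished" "(u', v', w') \<in> distinguished"
    "f \<in> Hom E (Dom E u) (Dom E u')" "g \<in> Hom E (Cod E u) (Cod E u')" "g \<cdot>\<^bsub>E\<^esub> u = u' \<cdot>\<^bsub>E\<^esub> f"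
  then show "\<exists>h. triangle_map E (u, v, w) (u', v', w') f g h" using completion by blast
qed

lemma exact_G: "exact_functor E distinguished C \<Delta> G"
  using G_functor G_susp by (simp add: exact_functor_def distinguished_def)

lemma exact_F: "exact_functor C \<Delta> E distinguished F"
  using F_functor F_susp F_distinguished by (simp add: exact_functor_def)

end

section \<open>The coidentifier of an idempotent transformation\<close>

text \<open>Isolates what the quotient construction owes to \<open>e\<close> alone, without
  reference to the functor that \<open>e\<close> comes from.\<close>

locale suspended_idempotent = suspended_category D
  for D :: "('o, 'm, 'z) susp_cat_scheme" (structure) +
  fixes e :: "'o \<Rightarrow> 'm"
  assumes e_natural: "nat_trans D D id_functor id_functor e"
    and e_idem: "X \<in> Obj D \<Longrightarrow> e X \<cdot> e X = e X"
    and e_susp: "trans_commutes_susp D D e"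
begin

abbreviation De :: "('o, 'm set) susp_cat" where "De \<equiv> coidentifier D e"
abbreviation cls :: "'m \<Rightarrow> 'm set" where "cls \<equiv> coid_class D e"

lemma e_simps [simp]:
  "X \<in> Obj D \<Longrightarrow> e X \<in> Arr D" "X \<in> Obj D \<Longrightarrow> Dom D (e X) = X" "X \<in> Obj D \<Longrightarrow> Cod D (e X) = X"
  using nat_transD(1-3)[OF e_natural] by (simp_all add: id_functor_def)

lemma e_comm: "\<lbrakk>f \<in> Arr D; Cod D f = B\<rbrakk> \<Longrightarrow> e B \<cdot> f = f \<cdot> e (Dom D f)"
  using nat_transD(4)[OF e_natural, of f] by (auto simp: id_functor_def)

text \<open>The operations may be computed on any representatives. Together with
  \<open>arr_clsE\<close> and \<open>hom_clsE\<close>, this lets the equational laws of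
  \<open>D\<close> pass to the quotient by rewriting.\<close>

lemma cls_simps [simp]:
  "Obj De = Obj D"
  "f \<in> Arr D \<Longrightarrow> cls f \<in> Arr De"
  "f \<in> Arr D \<Longrightarrow> Dom De (cls f) = Dom D f"
  "f \<in> Arr D \<Longrightarrow> Cod De (cls f) = Cod D f"
  "Ident De X = cls (Ident D X)"
  "Zero De X Y = cls (Zero D X Y)"
  "ObjMap (Susp De) = ObjMap (Susp D)"
  "\<lbrakk>f \<in> Arr D; g \<in> Arr D; Cod D f = Dom D g\<rbrakk> \<Longrightarrow> cls g \<cdot>\<^bsub>De\<^esub> cls f = cls (g \<cdot> f)"
  "\<lbrakk>f \<in> Arr D; g \<in> Arr D; Dom D f = Dom D g; Cod D f = Cod D g\<rbrakk>
    \<Longrightarrow> cls f \<oplus>\<^bsub>De\<^esub> cls g = cls (f \<oplus> g)"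
proof -
  show "f \<in> Arr D \<Longrightarrow> cls f \<in> Arr De"
    by (simp add: coidentifier_def coid_class_def quotientI)
  show "\<lbrakk>f \<in> Arr D; g \<in> Arr D; Cod D f = Dom D g\<rbrakk> \<Longrightarrow> cls g \<cdot>\<^bsub>De\<^esub> cls f = cls (g \<cdot> f)"
    by (rule coid_comp[OF e_natural])
  show "\<lbrakk>f \<in> Arr D; g \<in> Arr D; Dom D f = Dom D g; Cod D f = Cod D g\<rbrakk>
      \<Longrightarrow> cls f \<oplus>\<^bsub>De\<^esub> cls g = cls (f \<oplus> g)"
    by (rule coid_add[OF preadditive_category_axioms e_natural])
  show "f \<in> Arr D \<Longrightarrow> Dom De (cls f) = Dom D f" "f \<in> Arr D \<Longrightarrow> Cod De (cls f) = Cod D f"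
    by (simp_all add: coid_dom_cod)
qed (simp_all add: coidentifier_def)

lemma cls_eqI:
  assumes "f \<in> Arr D" "g \<in> Arr D" "Dom D f = Dom D g" "Cod D f = Cod D g"
    and "e (Cod D g) \<cdot> f = e (Cod D g) \<cdot> g"
  shows "cls f = cls g"
  using assms by (simp add: coid_class_eq_iff coid_rel_def)

lemma arr_clsE:
  assumes "K \<in> Arr De"
  obtains f where "f \<in> Arr D" "K = cls f"
  using assms by (auto simp: coidentifier_def coid_class_def quotient_def)

lemma hom_clsE:
  assumes "K \<in> Hom De A B"
  obtains f where "f \<in> Arr D" "Dom D f = A" "Cod D f = B" "K = cls f"
proof -
  have "K \<in> Arr De" using assms by (simp add: Hom_def)
  then obtain f where f: "f \<in> Arr D" "K = cls f" by (rule arr_clsE)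
  then show thesis using that[of f] assms by (simp add: Hom_def)
qed

lemma cls_hom: "\<lbrakk>f \<in> Arr D; Dom D f = A; Cod D f = B\<rbrakk> \<Longrightarrow> cls f \<in> Hom De A B"
  by (simp add: Hom_def)

lemma category_De: "category De"
proof
  show "Dom De K \<in> Obj De" "Cod De K \<in> Obj De" if "K \<in> Arr De" for K
    using that by (auto elim!: arr_clsE simp: dom_obj cod_obj)
  show "Ident De A \<in> Hom De A A" if "A \<in> Obj De" for A
    using that by (simp add: Hom_def)
  show "L \<cdot>\<^bsub>De\<^esub> K \<in> Hom De A E" if "K \<in> Hom De A B" "L \<in> Hom De B E" for K L A B E
    using that by (auto elim!: hom_clsE intro!: cls_hom)
  show "Ident De B \<cdot>\<^bsub>De\<^esub> K = K" "K \<cdot>\<^bsub>De\<^esub> Ident De A = K" if K: "K \<in> Hom De A B" for K A B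
  proof -
    obtain f where "f \<in> Arr D" "Dom D f = A" "Cod D f = B" "K = cls f"
      using K by (rule hom_clsE)
    moreover from this have "A \<in> Obj D" "B \<in> Obj D" using dom_obj cod_obj by auto
    ultimately show "Ident De B \<cdot>\<^bsub>De\<^esub> K = K" "K \<cdot>\<^bsub>De\<^esub> Ident De A = K" by simp_all
  qed
  show "(M \<cdot>\<^bsub>De\<^esub> L) \<cdot>\<^bsub>De\<^esub> K = M \<cdot>\<^bsub>De\<^esub> (L \<cdot>\<^bsub>De\<^esub> K)"
    if "K \<in> Hom De A B" "L \<in> Hom De B B'" "M \<in> Hom De B' E" for K L M A B B' E
    using that by (auto elim!: hom_clsE simp: comp_assoc_arr)
qed

lemma preadditive_De: "preadditive_category De"
proof (rule preadditive_category.intro[OF category_De], rule preadditive_category_axioms.intro)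
  fix A B assume "A \<in> Obj De" "B \<in> Obj De"
  then have AB [simp]: "A \<in> Obj D" "B \<in> Obj D" by simp_all
  show "comm_group (hom_group De A B)"
  proof (rule comm_groupI)
    fix K assume "K \<in> carrier (hom_group De A B)"
    then have "K \<in> Hom De A B" by (simp add: hom_group_def)
    then obtain f where f: "f \<in> Arr D" "Dom D f = A" "Cod D f = B" "K = cls f" by (rule hom_clsE)
    then show "\<one>\<^bsub>hom_group De A B\<^esub> \<otimes>\<^bsub>hom_group De A B\<^esub> K = K"
      by (simp add: hom_group_def)
    have "cls (Neg D f) \<in> carrier (hom_group De A B)"
      "cls (Neg D f) \<otimes>\<^bsub>hom_group De A B\<^esub> K = \<one>\<^bsub>hom_group De A B\<^esub>"
      using f by (simp_all add: hom_group_def Hom_def)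
    then show "\<exists>L \<in> carrier (hom_group De A B). L \<otimes>\<^bsub>hom_group De A B\<^esub> K = \<one>\<^bsub>hom_group De A B\<^esub>" by blast
  qed (auto simp: hom_group_def add_ac elim!: hom_clsE intro!: cls_hom)
next
  show "(L \<oplus>\<^bsub>De\<^esub> M) \<cdot>\<^bsub>De\<^esub> K = (L \<cdot>\<^bsub>De\<^esub> K) \<oplus>\<^bsub>De\<^esub> (M \<cdot>\<^bsub>De\<^esub> K)"
    if "K \<in> Hom De A B" "L \<in> Hom De B E" "M \<in> Hom De B E" for K L M A B E
    using that by (auto elim!: hom_clsE)
  show "M \<cdot>\<^bsub>De\<^esub> (K \<oplus>\<^bsub>De\<^esub> L) = (M \<cdot>\<^bsub>De\<^esub> K) \<oplus>\<^bsub>De\<^esub> (M \<cdot>\<^bsub>De\<^esub> L)"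
    if "K \<in> Hom De A B" "L \<in> Hom De A B" "M \<in> Hom De B E" for K L M A B E
    using that by (auto elim!: hom_clsE)
qed

lemma additive_De: "additive_category De"
proof (rule additive_category.intro[OF preadditive_De], rule additive_category_axioms.intro)
  interpret Q: preadditive_category De by (rule preadditive_De)
  obtain Z where Z: "zero_object D Z" using ex_zero_object by auto
  then have [simp]: "Z \<in> Obj D" by (simp add: zero_object_def)
  \<comment> \<open>Uniqueness of arrows does not descend by itself, but the equality of the
    identity and the zero arrow of \<open>Z\<close> does. The biproduct data below consist of
    equations and descend directly.\<close>
  have "zero_object De Z"
    using zero_object_hom(1)[OF Z, of "Ident D Z"] by (intro Q.zero_objectI) simp_all
  then show "\<exists>Z. zero_object De Z" ..
  fix A B assume "A \<in> Obj De" "B \<in> Obj De"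
  then have [simp]: "A \<in> Obj D" "B \<in> Obj D" by simp_all
  obtain P i j p q where P [simp]: "P \<in> Obj D" and i: "i \<in> Hom D A P" and j: "j \<in> Hom D B P"
    and p: "p \<in> Hom D P A" and q: "q \<in> Hom D P B"
    and eqs: "p \<cdot> i = Ident D A" "q \<cdot> j = Ident D B" "p \<cdot> j = Zero D B A" "q \<cdot> i = Zero D A B"
      "(i \<cdot> p) \<oplus> (j \<cdot> q) = Ident D P"
    using ex_biproduct[of A B] by auto
  note [simp] = HomD[OF i] HomD[OF j] HomD[OF p] HomD[OF q]
  show "\<exists>P \<in> Obj De. \<exists>i \<in> Hom De A P. \<exists>j \<in> Hom De B P. \<exists>p \<in> Hom De P A. \<exists>q \<in> Hom De P B.
      p \<cdot>\<^bsub>De\<^esub> i = Ident De A \<and> q \<cdot>\<^bsub>De\<^esub> j = Ident De B \<and>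
      p \<cdot>\<^bsub>De\<^esub> j = Zero De B A \<and> q \<cdot>\<^bsub>De\<^esub> i = Zero De A B \<and>
      (i \<cdot>\<^bsub>De\<^esub> p) \<oplus>\<^bsub>De\<^esub> (j \<cdot>\<^bsub>De\<^esub> q) = Ident De P"
    by (rule bexI[of _ P], rule bexI[of _ "cls i"], rule bexI[of _ "cls j"],
        rule bexI[of _ "cls p"], rule bexI[of _ "cls q"]) (simp_all add: eqs cls_hom)
qed

text \<open>A functor that commutes with \<open>e\<close> respects the congruence. The functor is
  arbitrary because both the suspension and its inverse must descend.\<close>

lemma cls_functor:
  assumes T: "is_functor D D T" and Te: "\<And>X. X \<in> Obj D \<Longrightarrow> e (ObjMap T X) = ArrMap T (e X)"
    and f: "f \<in> Arr D"
  shows "cls (ArrMap T (rep (cls f))) = cls (ArrMap T f)"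
proof -
  have "(f, rep (cls f)) \<in> coid_rel D e" using f by (rule rep_coid_class)
  then have r: "rep (cls f) \<in> Arr D" "Dom D (rep (cls f)) = Dom D f" "Cod D (rep (cls f)) = Cod D f"
      "e (Cod D f) \<cdot> f = e (Cod D f) \<cdot> rep (cls f)"
    by (auto simp: coid_rel_def)
  have "ArrMap T (e (Cod D f)) \<cdot> ArrMap T (rep (cls f)) = ArrMap T (e (Cod D f)) \<cdot> ArrMap T f"
    using arg_cong[OF r(4), of "ArrMap T"] r(1-3) f by (simp add: functorD[OF T] cod_obj)
  then show ?thesis
    using r(1-3) f by (intro cls_eqI) (simp_all add: functorD[OF T] cod_obj Te)
qed

lemma functor_De:
  assumes T: "is_functor D D T" and Te: "\<And>X. X \<in> Obj D \<Longrightarrow> e (ObjMap T X) = ArrMap T (e X)"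
  shows "is_functor De De \<lparr>ObjMap = ObjMap T, ArrMap = (\<lambda>K. cls (ArrMap T (rep K)))\<rparr>"
proof (rule is_functorI[OF category_De category_De])
  note [simp] = cls_functor[OF T Te] functorD[OF T]
  let ?T = "\<lparr>ObjMap = ObjMap T, ArrMap = (\<lambda>K. cls (ArrMap T (rep K)))\<rparr>"
  show "ObjMap ?T X \<in> Obj De" "ArrMap ?T (Ident De X) = Ident De (ObjMap ?T X)" if "X \<in> Obj De" for X
    using that by simp_all
  show "ArrMap ?T K \<in> Hom De (ObjMap ?T (Dom De K)) (ObjMap ?T (Cod De K))" if "K \<in> Arr De" for K
    using that by (auto elim!: arr_clsE simp: Hom_def)
  show "ArrMap ?T (L \<cdot>\<^bsub>De\<^esub> K) = ArrMap ?T L \<cdot>\<^bsub>De\<^esub> ArrMap ?T K"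
    if "K \<in> Arr De" "L \<in> Arr De" "Cod De K = Dom De L" for K L
    using that by (auto elim!: arr_clsE)
qed

lemma susp_De [simp]: "f \<in> Arr D \<Longrightarrow> ArrMap (Susp De) (cls f) = cls (ArrMap (Susp D) f)"
  using coid_susp[OF suspended_category_axioms e_natural e_susp]
  by (simp add: functor_eq_def comp_functor_def quotient_functor_def)

lemma suspended_De: "suspended_category De"
proof (rule suspended_category.intro[OF additive_De], rule suspended_category_axioms.intro)
  have "Susp De = \<lparr>ObjMap = ObjMap (Susp D), ArrMap = (\<lambda>K. cls (ArrMap (Susp D) (rep K)))\<rparr>"
    by (simp add: coidentifier_def)
  moreover have eS: "e (ObjMap (Susp D) X) = ArrMap (Susp D) (e X)" if "X \<in> Obj D" for X
    using e_susp that by (simp add: trans_commutes_susp_def)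
  ultimately show "is_functor De De (Susp De)"
    using functor_De[OF susp_functor] by simp
  obtain S where S: "is_functor D D S" and S1: "functor_eq D (S \<circ>\<^sub>F Susp D) id_functor"
    and S2: "functor_eq D (Susp D \<circ>\<^sub>F S) id_functor"
    using susp_invertible by auto
  note [simp] = functorD[OF S]
  have inv [simp]: "ObjMap S (ObjMap (Susp D) X) = X" "ObjMap (Susp D) (ObjMap S X) = X" if "X \<in> Obj D" for X
    using S1 S2 that by (simp_all add: functor_eq_def comp_functor_def id_functor_def)
  have inv' [simp]: "ArrMap S (ArrMap (Susp D) f) = f" "ArrMap (Susp D) (ArrMap S f) = f" if "f \<in> Arr D" for f
    using S1 S2 that by (simp_all add: functor_eq_def comp_functor_def id_functor_def)
  \<comment> \<open>Compatibility with \<open>e\<close> is assumed for the suspension only; applying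
    \<open>S\<close> to that equation at the object \<open>S X\<close> gives it for the
    inverse.\<close>
  have Se: "e (ObjMap S X) = ArrMap S (e X)" if X: "X \<in> Obj D" for X
  proof -
    have "ArrMap S (e X) = ArrMap S (ArrMap (Susp D) (e (ObjMap S X)))"
      using eS[of "ObjMap S X"] X by simp
    then show ?thesis using X by (simp del: e_simps add: e_simps(1))
  qed
  let ?S = "\<lparr>ObjMap = ObjMap S, ArrMap = (\<lambda>K. cls (ArrMap S (rep K)))\<rparr>"
  have "functor_eq De (?S \<circ>\<^sub>F Susp De) id_functor" "functor_eq De (Susp De \<circ>\<^sub>F ?S) id_functor"
    by (auto simp: functor_eq_def comp_functor_def id_functor_def cls_functor[OF S Se] elim!: arr_clsE)
  then show "\<exists>S. is_functor De De S \<and> functor_eq De (S \<circ>\<^sub>F Susp De) id_functor \<and>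
      functor_eq De (Susp De \<circ>\<^sub>F S) id_functor"
    using functor_De[OF S Se] by blast
qed

text \<open>A representative \<open>p\<close> of an idempotent class is idempotent only after
  composition with \<open>e X\<close>. But \<open>e X \<cdot> p\<close> is idempotent in
  \<open>D\<close> and has the class of \<open>p\<close>, so a splitting of it in \<open>D\<close>
  splits the class.\<close>

lemma idempotent_complete_De:
  assumes split: "idempotent_complete D"
  shows "idempotent_complete De"
  unfolding idempotent_complete_def
proof (intro ballI impI)
  fix X K assume "X \<in> Obj De" and K: "K \<in> Hom De X X" and KK: "K \<cdot>\<^bsub>De\<^esub> K = K"
  then have [simp]: "X \<in> Obj D" by simp
  obtain p where p [simp]: "p \<in> Arr D" "Dom D p = X" "Cod D p = X" and Kp: "K = cls p"
    using K by (rule hom_clsE)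
  have "cls (p \<cdot> p) = cls p" using KK by (simp add: Kp)
  then have epp: "e X \<cdot> (p \<cdot> p) = e X \<cdot> p" by (simp add: coid_class_eq_iff coid_rel_def)
  have comm: "p \<cdot> e X = e X \<cdot> p" using e_comm[of p X] by simp
  have "(e X \<cdot> p) \<cdot> (e X \<cdot> p) = e X \<cdot> p"
    by (simp add: comp_assoc_arr comp_reassoc[OF comm] epp comp_reassoc[OF e_idem])
  then obtain Y r s where [simp]: "Y \<in> Obj D" and r: "r \<in> Hom D X Y" and s: "s \<in> Hom D Y X"
    and sr: "s \<cdot> r = e X \<cdot> p" and rs: "r \<cdot> s = Ident D Y"
    using split unfolding idempotent_complete_def
    by (metis \<open>X \<in> Obj D\<close> HomI comp_arr e_simps p)
  note [simp] = HomD[OF r] HomD[OF s]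
  have "cls (e X \<cdot> p) = cls p"
    by (rule cls_eqI) (simp_all add: comp_reassoc[OF e_idem])
  then show "\<exists>Y \<in> Obj De. \<exists>r \<in> Hom De X Y. \<exists>s \<in> Hom De Y X. s \<cdot>\<^bsub>De\<^esub> r = K \<and> r \<cdot>\<^bsub>De\<^esub> s = Ident De Y"
    by (intro bexI[of _ Y] bexI[of _ "cls r"] bexI[of _ "cls s"]) (simp_all add: Kp sr rs cls_hom)
qed

end

section \<open>Semiseparability and the associated idempotent\<close>

lemma semiseparable_via_arr:
  assumes "semiseparable_via D C G P"
    and "X \<in> Obj D" "Y \<in> Obj D" "k \<in> Hom C (ObjMap G X) (ObjMap G Y)"
  shows "P X Y k \<in> Hom D X Y"
  using assms unfolding semiseparable_via_def by blast

lemma semiseparable_via_natural: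
  assumes "semiseparable_via D C G P"
    and "X \<in> Obj D" "Y \<in> Obj D" "X' \<in> Obj D" "Y' \<in> Obj D"
    and "f \<in> Hom D X' X" "g \<in> Hom D Y Y'" "k \<in> Hom C (ObjMap G X) (ObjMap G Y)"
  shows "P X' Y' (ArrMap G g \<cdot>\<^bsub>C\<^esub> (k \<cdot>\<^bsub>C\<^esub> ArrMap G f)) = g \<cdot>\<^bsub>D\<^esub> (P X Y k \<cdot>\<^bsub>D\<^esub> f)"
  using assms unfolding semiseparable_via_def by blast

text \<open>Naturality of \<open>P\<close> at an identity arrow of \<open>C\<close>. On the image of
  \<open>G\<close>, every choice of \<open>P\<close> is thus governed by its idempotent.\<close>

lemma semiseparable_via_image:
  assumes P: "semiseparable_via D C G P" and f: "f \<in> Arr D" "Dom D f = X" "Cod D f = Y"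
  shows "P X Y (ArrMap G f) = f \<cdot>\<^bsub>D\<^esub> P X X (Ident C (ObjMap G X))"
proof -
  have G: "is_functor D C G" using P by (simp add: semiseparable_via_def)
  interpret D: category D using G by (simp add: is_functor_def)
  interpret C: category C using G by (simp add: is_functor_def)
  have [simp]: "X \<in> Obj D" "Y \<in> Obj D" using f D.dom_obj D.cod_obj by auto
  have "P X X (Ident C (ObjMap G X)) \<in> Hom D X X"
    by (rule semiseparable_via_arr[OF P]) (simp_all add: Hom_def functorD[OF G])
  then show ?thesis
    using semiseparable_via_natural[OF P, of X X X Y "Ident D X" f "Ident C (ObjMap G X)"] f
    by (simp add: Hom_def functorD[OF G])
qed

text \<open>\<open>G\<close> sends both idempotents a and b to identities, so the preceding lemma
  gives a = b a for \<open>P\<close> and b = a b for \<open>P'\<close>; naturality of a identifies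
  the two products. This allows the \<open>P\<close> that witnesses stability to be used for the
  given \<open>e\<close>.\<close>

lemma associated_idempotent_unique:
  assumes P: "semiseparable_via D C G P" and P': "semiseparable_via D C G P'" and X: "X \<in> Obj D"
  shows "P X X (Ident C (ObjMap G X)) = P' X X (Ident C (ObjMap G X))"
proof -
  define a where "a = (\<lambda>X. P X X (Ident C (ObjMap G X)))"
  define b where "b = (\<lambda>X. P' X X (Ident C (ObjMap G X)))"
  have "associated_idempotent D C G a" "associated_idempotent D C G b"
    using P P' by (auto simp: associated_idempotent_def a_def b_def)
  note na = associated_idempotent_nat_trans[OF this(1)] and nb = associated_idempotent_nat_trans[OF this(2)]
  have h: "a X \<in> Arr D" "Dom D (a X) = X" "Cod D (a X) = X" "b X \<in> Arr D" "Dom D (b X) = X" "Cod D (b X) = X"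
    using nat_transD(1-3)[OF na(1)] nat_transD(1-3)[OF nb(1)] X by (simp_all add: id_functor_def)
  have "a X = b X \<cdot>\<^bsub>D\<^esub> a X"
    using semiseparable_via_image[OF P h(4-6)] nb(2)[OF X] by (simp add: a_def)
  also have "\<dots> = a X \<cdot>\<^bsub>D\<^esub> b X"
    using nat_transD(4)[OF na(1) h(4)] h by (simp add: id_functor_def)
  also have "\<dots> = b X"
    using semiseparable_via_image[OF P' h(1-3)] na(2)[OF X] by (simp add: b_def)
  finally show ?thesis by (simp add: a_def b_def)
qed

section \<open>Descent of the adjunction and conclusion\<close>

theorem theorem3p27:
  fixes C :: "('co, 'cm) susp_cat" and D :: "('do, 'dm) susp_cat"
    and \<Delta> :: "'cm triangle set"
    and F :: "('co, 'cm, 'do, 'dm) functor_data" and G :: "('do, 'dm, 'co, 'cm) functor_data"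
    and \<eta> :: "'co \<Rightarrow> 'cm" and \<epsilon> :: "'do \<Rightarrow> 'dm" and e :: "'do \<Rightarrow> 'dm"
  assumes "pretriangulated_category C \<Delta>"
    and "suspended_category D" and "idempotent_complete D"
    and "susp_adjunction C D F G \<eta> \<epsilon>"
    and "exact_functor C \<Delta> C \<Delta> (G \<circ>\<^sub>F F)"
    and "stably_semiseparable D C G"
    and "associated_idempotent D C G e"
  defines "De \<equiv> coidentifier D e"
    and "Ge \<equiv> coid_factor G"
    and "Fe \<equiv> quotient_functor D e \<circ>\<^sub>F F"
    and "\<Delta>e \<equiv> coid_distinguished D e G \<Delta>"
  shows "idempotent_complete De \<and>
    pretriangulated_category De \<Delta>e \<and>
    (\<exists>\<eta>' \<epsilon>'. adjunction C De Fe Ge \<eta>' \<epsilon>') \<and>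
    exact_functor De \<Delta>e C \<Delta> Ge \<and>
    exact_functor C \<Delta> De \<Delta>e Fe"
proof -
  interpret C: pretriangulated_category C \<Delta> by (rule assms)
  interpret D: suspended_category D by (rule assms)
  have adj: "adjunction C D F G \<eta> \<epsilon>" and comm: "functor_commutes_susp C D F" "functor_commutes_susp D C G"
    and trans: "trans_commutes_susp C C \<eta>" "trans_commutes_susp D D \<epsilon>"
    using assms(4) by (simp_all add: susp_adjunction_def)
  note F = adjunctionD(1)[OF adj] and G = adjunctionD(2)[OF adj]
  note [simp] = functorD[OF F] functorD[OF G] adjunction_simps(1-3,5-7)[OF adj]
  have [simp]: "X \<in> Obj C \<Longrightarrow> ObjMap F (ObjMap (Susp C) X) = ObjMap (Susp D) (ObjMap F X)"
    "f \<in> Arr C \<Longrightarrow> ArrMap F (ArrMap (Susp C) f) = ArrMap (Susp D) (ArrMap F f)"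
    "Y \<in> Obj D \<Longrightarrow> ObjMap G (ObjMap (Susp D) Y) = ObjMap (Susp C) (ObjMap G Y)"
    "g \<in> Arr D \<Longrightarrow> ArrMap G (ArrMap (Susp D) g) = ArrMap (Susp C) (ArrMap G g)" for X f Y g
    using comm by (simp_all add: functor_commutes_susp_def functor_eq_def comp_functor_def)
  obtain P where P: "semiseparable_via D C G P"
    and P_susp: "\<And>X Y k. \<lbrakk>X \<in> Obj D; Y \<in> Obj D; k \<in> Hom C (ObjMap G X) (ObjMap G Y)\<rbrakk>
      \<Longrightarrow> ArrMap (Susp D) (P X Y k) = P (ObjMap (Susp D) X) (ObjMap (Susp D) Y) (ArrMap (Susp C) k)"
    using assms(6) by (auto simp: stably_semiseparable_def)
  have eP: "e X = P X X (Ident C (ObjMap G X))" if "X \<in> Obj D" for X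
    using assms(7) associated_idempotent_unique[OF _ P that] that by (auto simp: associated_idempotent_def)
  note nt = associated_idempotent_nat_trans[OF assms(7)]
  have e_arr: "e X \<in> Arr D" "Dom D (e X) = X" "Cod D (e X) = X" if "X \<in> Obj D" for X
    using nat_transD(1-3)[OF nt(1) that] by (simp_all add: id_functor_def)
  interpret Q: suspended_idempotent D e
  proof
    show "nat_trans D D id_functor id_functor e" by (rule nt)
    \<comment> \<open>\<open>G (e X)\<close> is an identity, so \<open>P\<close> applied to it is
      \<open>e X\<close>; by \<open>semiseparable_via_image\<close> it is also the square of
      \<open>e X\<close>.\<close>
    show "e X \<cdot>\<^bsub>D\<^esub> e X = e X" if X: "X \<in> Obj D" for X
      using semiseparable_via_image[OF P e_arr[OF X]] nt(2)[OF X] eP[OF X] by simp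
    show "trans_commutes_susp D D e"
      unfolding trans_commutes_susp_def
      using P_susp[of X X "Ident C (ObjMap G X)" for X] by (auto simp: eP Hom_def)
  qed
  \<comment> \<open>Here semiseparability of \<open>G\<close> becomes separability of
    \<open>Ge\<close>: in \<open>D\<close> the left side is represented by \<open>f\<close> followed
    by \<open>e\<close>, which is congruent to \<open>f\<close>.\<close>
  have P_G: "Q.cls (P (Dom D f) (Cod D f) (ArrMap G f)) = Q.cls f" if f: "f \<in> Arr D" for f
  proof -
    have [simp]: "Dom D f \<in> Obj D" "Cod D f \<in> Obj D" using f by (simp_all add: D.dom_obj D.cod_obj)
    have "P (Dom D f) (Cod D f) (ArrMap G f) = e (Cod D f) \<cdot>\<^bsub>D\<^esub> f"
      using semiseparable_via_image[OF P f refl refl] Q.e_comm[OF f refl] by (simp add: eP)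
    then show ?thesis
      using f by (intro Q.cls_eqI) (simp_all add: D.comp_reassoc[OF Q.e_idem])
  qed
  have Ge: "ArrMap Ge (Q.cls f) = ArrMap G f" if "f \<in> Arr D" for f
    using coid_factorization[OF assms(7)] that
    by (simp add: functor_eq_def comp_functor_def quotient_functor_def Ge_def)
  have Ge_obj: "ObjMap Ge = ObjMap G" by (simp add: Ge_def coid_factor_def)
  have Fe: "ObjMap Fe = ObjMap F" "ArrMap Fe f = Q.cls (ArrMap F f)" for f
    by (auto simp: Fe_def quotient_functor_def comp_functor_def)
  note [simp] = Ge Ge_obj Fe
  have Ge_functor: "is_functor De C Ge"
    unfolding De_def by (rule is_functorI[OF Q.category_De C.category_axioms])
      (auto elim!: Q.arr_clsE simp: Hom_def)
  have Fe_functor: "is_functor C De Fe"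
    unfolding De_def by (rule is_functorI[OF C.category_axioms Q.category_De]) (simp_all add: Q.cls_hom)
  have Fe_Ge_functor: "is_functor De De (Fe \<circ>\<^sub>F Ge)"
    unfolding De_def by (rule is_functorI[OF Q.category_De Q.category_De])
      (auto elim!: Q.arr_clsE simp: comp_functor_def intro!: Q.cls_hom)
  have Ge_Fe_functor: "is_functor C C (Ge \<circ>\<^sub>F Fe)"
    by (rule is_functorI[OF C.category_axioms C.category_axioms]) (simp_all add: comp_functor_def Hom_def)
  \<comment> \<open>\<open>Ge\<close> after \<open>Fe\<close> agrees with the monad on
    \<open>C\<close>, so the unit is unchanged; only the counit is replaced by its class.\<close>
  have "nat_trans C C id_functor (Ge \<circ>\<^sub>F Fe) \<eta>"
    using Ge_Fe_functor adjunction_simps(4)[OF adj] adjunctionD(3)[OF adj]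
    by (simp add: nat_trans_def comp_functor_def id_functor_def)
  moreover have "nat_trans De De (Fe \<circ>\<^sub>F Ge) id_functor (\<lambda>Y. Q.cls (\<epsilon> Y))"
    using Fe_Ge_functor adjunction_simps(8)[OF adj] Q.category_De
    by (auto simp: nat_trans_def comp_functor_def id_functor_def De_def is_functor_def D.dom_obj D.cod_obj
        elim!: Q.arr_clsE intro!: Q.cls_hom)
  ultimately have adj': "adjunction C De Fe Ge \<eta> (\<lambda>Y. Q.cls (\<epsilon> Y))"
    using Fe_functor Ge_functor adjunctionD(5,6)[OF adj] by (simp add: adjunction_def De_def)
  interpret E: separable_adjunction C \<Delta> De Fe Ge \<eta> "\<lambda>Y. Q.cls (\<epsilon> Y)" "\<lambda>X Y k. Q.cls (P X Y k)"
  proof (rule separable_adjunction.intro[OF assms(1)])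
    show "suspended_category De" unfolding De_def by (rule Q.suspended_De)
    show "separable_adjunction_axioms C \<Delta> De Fe Ge \<eta> (\<lambda>Y. Q.cls (\<epsilon> Y)) (\<lambda>X Y k. Q.cls (P X Y k))"
    proof
      show "idempotent_complete De" unfolding De_def by (rule Q.idempotent_complete_De) (rule assms)
      show "susp_adjunction C De Fe Ge \<eta> (\<lambda>Y. Q.cls (\<epsilon> Y))"
        using adj' trans
        by (auto simp: susp_adjunction_def functor_commutes_susp_def functor_eq_def comp_functor_def
            trans_commutes_susp_def De_def elim!: Q.arr_clsE)
      \<comment> \<open>The two composites are compared on arrows of \<open>C\<close> only, which
        suffices because distinguished triangles consist of such arrows.\<close>
      have "map_triangle (Ge \<circ>\<^sub>F Fe) t = map_triangle (G \<circ>\<^sub>F F) t" if "t \<in> \<Delta>" for t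
        using that C.distinguished_triangles by (cases t) (auto simp: comp_functor_def triangles_def)
      then show "exact_functor C \<Delta> C \<Delta> (Ge \<circ>\<^sub>F Fe)"
        using assms(5) Ge_Fe_functor
        by (simp add: exact_functor_def functor_commutes_susp_def functor_eq_def comp_functor_def)
      fix X Y assume "X \<in> Obj De" "Y \<in> Obj De"
      then have [simp]: "X \<in> Obj D" "Y \<in> Obj D" by (simp_all add: De_def)
      show "Q.cls (P X Y (ArrMap Ge K)) = K" if "K \<in> Hom De X Y" for K
        using that P_G unfolding De_def by (auto elim!: Q.hom_clsE)
    next
      show "semiseparable_via De C Ge (\<lambda>X Y k. Q.cls (P X Y k))"
        unfolding semiseparable_via_def
      proof (intro conjI ballI)
        show "is_functor De C Ge" by (rule Ge_functor)
        fix X Y assume "X \<in> Obj De" "Y \<in> Obj De"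
        then have XY [simp]: "X \<in> Obj D" "Y \<in> Obj D" by (simp_all add: De_def)
        show "Q.cls (P X Y k) \<in> Hom De X Y" if "k \<in> Hom C (ObjMap Ge X) (ObjMap Ge Y)" for k
          using that semiseparable_via_arr[OF P, of X Y k] by (simp add: De_def Hom_def)
        show "ArrMap Ge (Q.cls (P X Y (ArrMap Ge K))) = ArrMap Ge K" if "K \<in> Hom De X Y" for K
          using that P_G unfolding De_def by (auto elim!: Q.hom_clsE)
        fix X' Y' K L k
        assume "X' \<in> Obj De" "Y' \<in> Obj De" and K: "K \<in> Hom De X' X" and L: "L \<in> Hom De Y Y'"
          and k: "k \<in> Hom C (ObjMap Ge X) (ObjMap Ge Y)"
        then have XY' [simp]: "X' \<in> Obj D" "Y' \<in> Obj D" by (simp_all add: De_def)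
        obtain f where f: "f \<in> Arr D" "Dom D f = X'" "Cod D f = X" "K = Q.cls f"
          using K unfolding De_def by (rule Q.hom_clsE)
        obtain g where g: "g \<in> Arr D" "Dom D g = Y" "Cod D g = Y'" "L = Q.cls g"
          using L unfolding De_def by (rule Q.hom_clsE)
        show "Q.cls (P X' Y' (ArrMap Ge L \<cdot>\<^bsub>C\<^esub> (k \<cdot>\<^bsub>C\<^esub> ArrMap Ge K))) = L \<cdot>\<^bsub>De\<^esub> (Q.cls (P X Y k) \<cdot>\<^bsub>De\<^esub> K)"
          using semiseparable_via_natural[OF P XY XY' HomI[OF f(1-3)] HomI[OF g(1-3)], of k] k f g
            HomD[OF semiseparable_via_arr[OF P XY, of k]]
          by (simp add: De_def)
      qed
    qed
  qed
  have "E.distinguished = \<Delta>e"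
    by (subst E.distinguished_def) (simp only: \<Delta>e_def coid_distinguished_def De_def Ge_def)
  then show ?thesis
    using E.idempotents_split E.pretriangulated E.exact_G E.exact_F adj' by auto
qed

end
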